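(* Let $K\in\mathbb{N}$ and $0<\tau_1<\cdots<\tau_K$. Suppose that $S_i\in W_2^{n\times n}[-\tau_i,0]$, $R_{ij}\in W_2^{n\times n}\left[[-\tau_i,0]\times[-\tau_j,0]\right]$, and that $S_i(s)=S_i(s)^T$, $R_{ij}(s,\theta)=R_{ji}(\theta,s)^T$, $P=\tau_KQ_i(0)^T + \tau_KS_i(0)$ and $Q_j(s)=R_{ij}(0,s)$ for all $i,j\in \{1,\dots,K\}$. Then the operator $$\left(\mathcal{P}_{\{P,Q_i,S_i,R_{ij}\}} \begin{bmatrix}x\\ \phi_i\end{bmatrix}\right)(s) :=\begin{bmatrix} P x + \sum_{i=1}^K \int_{-\tau_i}^0 Q_i(\theta)\phi_i(\theta)\, d \theta \\ \tau_K Q_i(s)^T x + \tau_K S_i(s)\phi_i(s) + \sum_{j=1}^K \int_{-\tau_j}^0 R_{ij}(s,\theta)\phi_j(\theta)\, d \theta \end{bmatrix}$$ is a bounded linear operator, maps $X \rightarrow X$, and is self-adjoint with respect to the inner product defined on $Z_{n,K}$.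
   Context: $L_2^m[D]$ denotes the square-integrable functions $D\to\mathbb{R}^m$ and $W_2^m[D]=\{x: x,\dot x\in L_2^m[D]\}$; $W_2^{n\times m}$ is the matrix-valued analogue (for functions of two variables, first-order partial derivatives in $L_2$). Functions in $W_2$ are regarded as continuous, and $Q_i,S_i,R_{ij}$ are assumed sufficiently smooth that the one-variable sections that occur (e.g. $s\mapsto R_{ij}(0,s)$) are well defined and lie in $W_2$. $Z_{n,K}:=\mathbb{R}^n\times L_2^n[-\tau_1,0]\times\cdots\times L_2^n[-\tau_K,0]$; its elements $\{x,\phi_1,\dots,\phi_K\}$ are written $\begin{bmatrix} x\\ \phi_i\end{bmatrix}$, and the second row in the formula for an operator specifies the component with index $i$, for $s\in[-\tau_i,0]$, for each $i\in\{1,\dots,K\}$. The inner product is $$\left\langle \begin{bmatrix} y\\ \psi_i\end{bmatrix},\begin{bmatrix} x\\ \phi_i\end{bmatrix}\right\rangle_{Z_{n,K}}=\tau_K y^Tx+\sum_{i=1}^K\int_{-\tau_i}^0\psi_i(s)^T\phi_i(s)\,ds .$$ The state space is $X:=\{\begin{bmatrix} x\\ \phi_i\end{bmatrix}\in Z_{n,K}: \phi_i\in W_2^n[-\tau_i,0] \text{ and } \phi_i(0)=x \text{ for all } i\}$, with the inner product and norm of $Z_{n,K}$. Self-adjoint means $\langle z,\mathcal{P}w\rangle_{Z_{n,K}}=\langle \mathcal{P}z,w\rangle_{Z_{n,K}}$ for all $z,w\in X$. *)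

theory Defs
  imports "HOL-Analysis.Analysis"
begin

definition L2 :: "'a::euclidean_space set \<Rightarrow> ('a \<Rightarrow> 'b::euclidean_space) set" where
  "L2 D = {f. f \<in> borel_measurable (lebesgue_on D) \<and>
              integrable (lebesgue_on D) (\<lambda>x. (norm (f x))\<^sup>2)}"

text \<open>Test functions are of class \<open>C\<^sup>1\<close>; for first-order weak derivatives this is the usual
  alternative to smooth test functions, and it defines the same spaces.\<close>

definition test_function :: "'a::euclidean_space set \<Rightarrow> ('a \<Rightarrow> real) \<Rightarrow> bool" where
  "test_function D \<eta> \<longleftrightarrow>
     \<eta> differentiable_on UNIV \<and>
     (\<forall>b\<in>Basis. continuous_on UNIV (\<lambda>x. frechet_derivative \<eta> (at x) b)) \<and>
     (\<exists>C. compact C \<and> C \<subseteq> interior D \<and> (\<forall>x. x \<notin> C \<longrightarrow> \<eta> x = 0))"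

definition weak_partial ::
    "'a::euclidean_space set \<Rightarrow> 'a \<Rightarrow> ('a \<Rightarrow> 'b::euclidean_space) \<Rightarrow> ('a \<Rightarrow> 'b) \<Rightarrow> bool" where
  "weak_partial D b f g \<longleftrightarrow>
     (\<forall>\<eta>. test_function D \<eta> \<longrightarrow>
        (LINT x|lebesgue_on D. frechet_derivative \<eta> (at x) b *\<^sub>R f x) =
        - (LINT x|lebesgue_on D. \<eta> x *\<^sub>R g x))"

text \<open>Elements of the Sobolev space are represented by their continuous representatives.
  The basis is \<open>{1}\<close> on the real line and \<open>{(1,0), (0,1)}\<close> in the plane.\<close>

definition W2 :: "'a::euclidean_space set \<Rightarrow> ('a \<Rightarrow> 'b::euclidean_space) set" where
  "W2 D = {f. continuous_on D f \<and> f \<in> L2 D \<and>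
              (\<forall>b\<in>Basis. \<exists>g\<in>L2 D. weak_partial D b f g)}"

text \<open>An element \<open>(x, \<phi>)\<close> has components \<open>\<phi> i\<close> for \<open>i \<in> {1..K}\<close>, viewed on \<open>{-\<tau> i..0}\<close>.
  Values of \<open>\<phi>\<close> for other indices or arguments are irrelevant. Square-integrable functions
  are represented by functions rather than by classes modulo null sets, so that \<open>Z_norm\<close> is
  a seminorm on representatives.\<close>

type_synonym 'n zvec = "(real ^ 'n) \<times> (nat \<Rightarrow> real \<Rightarrow> real ^ 'n)"

definition Z_space :: "nat \<Rightarrow> (nat \<Rightarrow> real) \<Rightarrow> ('n::finite) zvec set" where
  "Z_space K \<tau> = {(x, \<phi>). \<forall>i\<in>{1..K}. \<phi> i \<in> L2 {-\<tau> i..0}}"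

definition X_space :: "nat \<Rightarrow> (nat \<Rightarrow> real) \<Rightarrow> ('n::finite) zvec set" where
  "X_space K \<tau> =
     {(x, \<phi>) \<in> Z_space K \<tau>. \<forall>i\<in>{1..K}. \<phi> i \<in> W2 {-\<tau> i..0} \<and> \<phi> i 0 = x}"

definition Z_add :: "('n::finite) zvec \<Rightarrow> 'n zvec \<Rightarrow> 'n zvec" where
  "Z_add z w = (fst z + fst w, \<lambda>i s. snd z i s + snd w i s)"

definition Z_scale :: "real \<Rightarrow> ('n::finite) zvec \<Rightarrow> 'n zvec" where
  "Z_scale c z = (c *\<^sub>R fst z, \<lambda>i s. c *\<^sub>R snd z i s)"

definition Z_inner :: "nat \<Rightarrow> (nat \<Rightarrow> real) \<Rightarrow> ('n::finite) zvec \<Rightarrow> 'n zvec \<Rightarrow> real" where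
  "Z_inner K \<tau> z w =
     \<tau> K * (fst z \<bullet> fst w) +
     (\<Sum>i=1..K. LINT s|lebesgue_on {-\<tau> i..0}. snd z i s \<bullet> snd w i s)"

definition Z_norm :: "nat \<Rightarrow> (nat \<Rightarrow> real) \<Rightarrow> ('n::finite) zvec \<Rightarrow> real" where
  "Z_norm K \<tau> z = sqrt (Z_inner K \<tau> z z)"

definition bounded_linear_operator_on ::
    "nat \<Rightarrow> (nat \<Rightarrow> real) \<Rightarrow> ('n::finite) zvec set \<Rightarrow> ('n zvec \<Rightarrow> 'n zvec) \<Rightarrow> bool" where
  "bounded_linear_operator_on K \<tau> V T \<longleftrightarrow>
     (\<forall>z\<in>V. T z \<in> V) \<and>
     (\<forall>z\<in>V. \<forall>w\<in>V. T (Z_add z w) = Z_add (T z) (T w)) \<and>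
     (\<forall>c. \<forall>z\<in>V. T (Z_scale c z) = Z_scale c (T z)) \<and>
     (\<exists>C. \<forall>z\<in>V. Z_norm K \<tau> (T z) \<le> C * Z_norm K \<tau> z)"

definition self_adjoint_on_X ::
    "nat \<Rightarrow> (nat \<Rightarrow> real) \<Rightarrow> (('n::finite) zvec \<Rightarrow> 'n zvec) \<Rightarrow> bool" where
  "self_adjoint_on_X K \<tau> T \<longleftrightarrow>
     (\<forall>z\<in>X_space K \<tau>. \<forall>w\<in>X_space K \<tau>. Z_inner K \<tau> z (T w) = Z_inner K \<tau> (T z) w)"

text \<open>The result is set to \<open>0\<close> where the components carry no information, which makes
  linearity a literal equation between representatives.\<close>

definition P_op ::
    "nat \<Rightarrow> (nat \<Rightarrow> real) \<Rightarrow> real ^ 'n ^ 'n \<Rightarrow> (nat \<Rightarrow> real \<Rightarrow> real ^ 'n ^ 'n) \<Rightarrow>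
     (nat \<Rightarrow> real \<Rightarrow> real ^ 'n ^ 'n) \<Rightarrow> (nat \<Rightarrow> nat \<Rightarrow> real \<Rightarrow> real \<Rightarrow> real ^ 'n ^ 'n) \<Rightarrow>
     ('n::finite) zvec \<Rightarrow> 'n zvec" where
  "P_op K \<tau> P Q S R = (\<lambda>(x, \<phi>).
     (P *v x + (\<Sum>i=1..K. LINT \<theta>|lebesgue_on {-\<tau> i..0}. Q i \<theta> *v \<phi> i \<theta>),
      \<lambda>i s. if i \<in> {1..K} \<and> s \<in> {-\<tau> i..0}
            then \<tau> K *\<^sub>R (transpose (Q i s) *v x) + \<tau> K *\<^sub>R (S i s *v \<phi> i s) +
                 (\<Sum>j=1..K. LINT \<theta>|lebesgue_on {-\<tau> j..0}. R i j s \<theta> *v \<phi> j \<theta>)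
            else 0))"

end

(* The only analytic point is that the second component of the image lies in W2. On an interval,
   a continuous function with an integrable weak derivative is the primitive of that derivative (du
   Bois-Reymond), and primitives satisfy the product rule by Fubini's theorem on a triangle; this
   handles S_i phi_i. For the integral of R_ij(s,.) phi_j one tests the weak s-derivative of R_ij
   against product test functions eta(s) psi(theta) and passes from psi to phi_j with the product
   rule. The boundary condition phi_i(0) = x is preserved because of the relations between P, Q_i,
   S_i and R_ij at 0, boundedness is Cauchy-Schwarz on each interval, and self-adjointness follows
   from the symmetry of P, S_i and R_ij together with Fubini's theorem. *)

theory Submission
  imports Defs
begin

section \<open>Primitives on an interval\<close>

text \<open>The delicate term is the integral with kernel \<open>R i j\<close>. Its s-derivative
  exists only as an \<open>L2\<close> function of two variables, so the individual sections at fixed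
  \<theta> carry no derivative that could be integrated. The weak identity can be tested with
  products of test functions, but \<open>\<phi> j\<close> is neither C^1 nor zero near the ends of
  its interval. The way out is one-dimensional: an integrable function that is orthogonal to all
  test functions is the density of the zero function, and in the product rule the boundary values of
  \<open>\<phi> j\<close> are then multiplied by zero. The weight \<open>\<tau> K\<close> in
  \<open>Z_inner\<close> equals the factor of \<open>transpose (Q i s) *v x\<close> in the operator.
  For this reason the two mixed terms containing \<open>Q\<close> trade places when the arguments of
  the form are exchanged. The norm estimate needs only coefficients that are bounded on compact
  sets. It is therefore carried out on all of \<open>Z_space\<close>, where the components need not
  be continuous, and the same constant serves \<open>X_space\<close>.\<close>

lemma lborel_product_integrable:
  fixes g h :: "real \<Rightarrow> real"
  assumes "integrable lborel g" "integrable lborel h"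
  shows "integrable (lborel \<Otimes>\<^sub>M lborel) (\<lambda>(u, v). g u * h v)"
proof (rule lborel_pair.Fubini_integrable)
  have [measurable]: "g \<in> borel_measurable borel" "h \<in> borel_measurable borel"
    using assms[THEN borel_measurable_integrable] by auto
  show "(\<lambda>(u, v). g u * h v) \<in> borel_measurable (lborel \<Otimes>\<^sub>M lborel)"
    by measurable
  show "integrable lborel (\<lambda>u. LINT v|lborel. norm (case (u, v) of (u, v) \<Rightarrow> g u * h v))"
    using assms by (simp add: abs_mult)
  show "AE u in lborel. integrable lborel (\<lambda>v. case (u, v) of (u, v) \<Rightarrow> g u * h v)"
    using assms by simp
qed

text \<open>The half planes \<open>u \<le> v\<close> and \<open>v < u\<close> partition the plane,
  so the integrals of \<open>g u * h v\<close> over them add up to the product of the two integrals.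
  \<open>A\<close> and \<open>B\<close> are the two pieces, and Fubini turns each of them into one
  summand on the left.\<close>

lemma lborel_integration_by_parts:
  fixes g h :: "real \<Rightarrow> real"
  assumes g: "integrable lborel g" and h: "integrable lborel h"
  shows "integrable lborel (\<lambda>v. h v * (LBINT u:{..v}. g u))" (is ?I)
    and "(LBINT v. h v * (LBINT u:{..v}. g u)) + (LBINT u. g u * (LBINT v:{..u}. h v)) =
         (LBINT u. g u) * (LBINT v. h v)" (is ?E)
proof -
  have [measurable]: "g \<in> borel_measurable borel" "h \<in> borel_measurable borel"
    using g h by (auto dest: borel_measurable_integrable)
  define A where "A = (\<lambda>u v. (if u \<le> v then 1 else 0) * (g u * h v))"
  define B where "B = (\<lambda>u v. (if v < u then 1 else 0) * (g u * h v))"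
  have gh: "integrable (lborel \<Otimes>\<^sub>M lborel) (\<lambda>(u, v). g u * h v)"
    by (rule lborel_product_integrable[OF g h])
  have A: "integrable (lborel \<Otimes>\<^sub>M lborel) (case_prod A)"
    by (rule Bochner_Integration.integrable_bound[OF gh]) (auto simp: A_def)
  have B: "integrable (lborel \<Otimes>\<^sub>M lborel) (case_prod B)"
    by (rule Bochner_Integration.integrable_bound[OF gh]) (auto simp: B_def)
  have Asec: "(LBINT u. A u v) = h v * (LBINT u:{..v}. g u)" for v
  proof -
    have "(LBINT u. A u v) = (LBINT u. h v * (indicat_real {..v} u *\<^sub>R g u))"
      by (rule Bochner_Integration.integral_cong) (auto simp: A_def indicator_def)
    then show ?thesis by (simp add: set_lebesgue_integral_def)
  qed
  have Bsec: "(LBINT v. B u v) = g u * (LBINT v:{..u}. h v)" for u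
  proof -
    have "(LBINT v. B u v) = (LBINT v. g u * (indicat_real {..u} v *\<^sub>R h v))"
    proof (rule integral_cong_AE)
      \<comment> \<open>The strict inequality in \<open>B\<close> differs from \<open>{..u}\<close>
        only by the point \<open>u\<close>, which is a null set.\<close>
      show "AE v in lborel. B u v = g u * (indicat_real {..u} v *\<^sub>R h v)"
        using AE_lborel_singleton[of u] by eventually_elim (auto simp: B_def indicator_def)
    qed (auto simp: B_def)
    then show ?thesis by (simp add: set_lebesgue_integral_def)
  qed
  show ?I
    using lborel_pair.integrable_snd[OF A] unfolding Asec .
  have "(LBINT v. h v * (LBINT u:{..v}. g u)) = integral\<^sup>L (lborel \<Otimes>\<^sub>M lborel) (case_prod A)"
    using lborel_pair.integral_snd[OF A] unfolding Asec .
  moreover have "(LBINT u. g u * (LBINT v:{..u}. h v)) = integral\<^sup>L (lborel \<Otimes>\<^sub>M lborel) (case_prod B)"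
    using lborel_pair.integral_fst[OF B] unfolding Bsec .
  moreover have "integral\<^sup>L (lborel \<Otimes>\<^sub>M lborel) (case_prod A) + integral\<^sup>L (lborel \<Otimes>\<^sub>M lborel) (case_prod B)
      = (LBINT u. g u) * (LBINT v. h v)"
  proof -
    have "integral\<^sup>L (lborel \<Otimes>\<^sub>M lborel) (case_prod A) + integral\<^sup>L (lborel \<Otimes>\<^sub>M lborel) (case_prod B)
        = integral\<^sup>L (lborel \<Otimes>\<^sub>M lborel) (\<lambda>z. case_prod A z + case_prod B z)"
      using A B by simp
    also have "\<dots> = integral\<^sup>L (lborel \<Otimes>\<^sub>M lborel) (\<lambda>(u, v). g u * h v)"
      by (rule Bochner_Integration.integral_cong) (auto simp: A_def B_def)
    also have "\<dots> = (LBINT u. LBINT v. g u * h v)"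
      using lborel_pair.integral_fst[OF gh] by simp
    finally show ?thesis by simp
  qed
  ultimately show ?E by linarith
qed

text \<open>Absolute continuity with an explicit density. The density lives on the whole line and
  vanishes off the interval, so that primitives are integrals over \<open>{..t}\<close> for
  \<open>lborel\<close> and Fubini applies without restricted measures; \<open>f\<close> itself is
  constrained on the interval only. Square integrability of the density is kept apart because the
  product rule already holds for integrable densities.\<close>

definition primitive_on :: "real \<Rightarrow> real \<Rightarrow> (real \<Rightarrow> real) \<Rightarrow> (real \<Rightarrow> real) \<Rightarrow> bool" where
  "primitive_on a b f g \<longleftrightarrow> integrable lborel g \<and> (\<forall>x. x \<notin> {a..b} \<longrightarrow> g x = 0) \<and>
     (\<forall>t\<in>{a..b}. f t = f a + (LBINT u:{..t}. g u))"

lemma primitive_on_mult: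
  assumes f: "primitive_on a b f g" and h: "primitive_on a b h k"
  shows "primitive_on a b (\<lambda>t. f t * h t) (\<lambda>t. f t * k t + g t * h t)"
proof -
  define G where "G t = (LBINT u:{..t}. g u)" for t
  define H where "H t = (LBINT u:{..t}. k u)" for t
  have g: "integrable lborel g" and g0: "\<And>x. x \<notin> {a..b} \<Longrightarrow> g x = 0"
    and fG: "\<And>t. t \<in> {a..b} \<Longrightarrow> f t = f a + G t"
    using f unfolding primitive_on_def G_def by blast+
  have k: "integrable lborel k" and k0: "\<And>x. x \<notin> {a..b} \<Longrightarrow> k x = 0"
    and hH: "\<And>t. t \<in> {a..b} \<Longrightarrow> h t = h a + H t"
    using h unfolding primitive_on_def H_def by blast+
  \<comment> \<open>Writing each factor as its value at \<open>a\<close> plus a primitive isolates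
    \<open>k t * G t\<close> and \<open>g t * H t\<close>, the two products covered by integration
    by parts. Off the interval both densities vanish, so the unknown values of \<open>f\<close> and
    \<open>h\<close> do not matter.\<close>
  have dens: "f t * k t + g t * h t = f a * k t + k t * G t + (h a * g t + g t * H t)" for t
  proof (cases "t \<in> {a..b}")
    case True
    show ?thesis
      unfolding fG[OF True] hH[OF True] by (simp add: algebra_simps)
  qed (simp add: g0 k0)
  have int: "integrable lborel (\<lambda>t. k t * G t)" "integrable lborel (\<lambda>t. g t * H t)"
    using lborel_integration_by_parts(1)[OF g k] lborel_integration_by_parts(1)[OF k g]
    by (auto simp: G_def H_def)
  have upto: "(LBINT v:{..t}. k v * G v) + (LBINT v:{..t}. g v * H v) = G t * H t" for t
  proof -
    \<comment> \<open>Cutting both densities off at \<open>t\<close> turns the identity on the whole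
      line into the identity up to \<open>t\<close>. For \<open>v \<le> t\<close> the cut-off inside
      the inner integral has no effect.\<close>
    let ?g = "\<lambda>v. indicator {..t} v * g v" and ?k = "\<lambda>v. indicator {..t} v * k v"
    have "integrable lborel ?g" "integrable lborel ?k"
      using g k by (auto intro: integrable_real_mult_indicator simp: mult.commute)
    from lborel_integration_by_parts(2)[OF this]
    have *: "(LBINT v. ?k v * (LBINT u:{..v}. ?g u)) + (LBINT u. ?g u * (LBINT v:{..u}. ?k v)) =
      (LBINT u. ?g u) * (LBINT v. ?k v)" .
    have e1: "?k v * (LBINT u:{..v}. ?g u) = indicator {..t} v *\<^sub>R (k v * G v)" for v
      unfolding G_def set_lebesgue_integral_def
      by (auto simp: indicator_def intro!: Bochner_Integration.integral_cong)
    have e2: "?g v * (LBINT u:{..v}. ?k u) = indicator {..t} v *\<^sub>R (g v * H v)" for v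
      unfolding H_def set_lebesgue_integral_def
      by (auto simp: indicator_def intro!: Bochner_Integration.integral_cong)
    show ?thesis
      using * unfolding e1 e2 by (simp add: set_lebesgue_integral_def G_def H_def)
  qed
  have set_int: "set_integrable lborel {..t} p" if "integrable lborel p" for p :: "real \<Rightarrow> real" and t
    using that unfolding set_integrable_def by (intro integrable_mult_indicator) auto
  have "(LBINT u:{..t}. f u * k u + g u * h u) = f a * H t + h a * G t + G t * H t" for t
  proof -
    have "(LBINT u:{..t}. f u * k u + g u * h u) =
        (LBINT u:{..t}. f a * k u + k u * G u) + (LBINT u:{..t}. h a * g u + g u * H u)"
      unfolding dens using g k int by (intro set_integral_add(2) set_int) auto
    also have "(LBINT u:{..t}. f a * k u + k u * G u) = (LBINT u:{..t}. f a * k u) + (LBINT u:{..t}. k u * G u)"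
      using g k int by (intro set_integral_add(2) set_int) auto
    also have "(LBINT u:{..t}. h a * g u + g u * H u) = (LBINT u:{..t}. h a * g u) + (LBINT u:{..t}. g u * H u)"
      using g k int by (intro set_integral_add(2) set_int) auto
    finally show ?thesis
      using upto[of t] by (simp add: G_def H_def)
  qed
  moreover have "f t * h t = f a * h a + (f a * H t + h a * G t + G t * H t)" if "t \<in> {a..b}" for t
    unfolding fG[OF that] hH[OF that] by (simp add: algebra_simps)
  moreover have "integrable lborel (\<lambda>t. f t * k t + g t * h t)"
    unfolding dens using g k int by simp
  moreover have "f t * k t + g t * h t = 0" if "t \<notin> {a..b}" for t
    using g0[OF that] k0[OF that] by simp
  ultimately show ?thesis
    unfolding primitive_on_def by (intro conjI ballI allI impI) (simp_all only:)
qed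

section \<open>Passage between \<open>lebesgue_on\<close> and \<open>lborel\<close>, and weak
  derivatives of primitives\<close>

lemma
  fixes f :: "'a::euclidean_space \<Rightarrow> real"
  assumes S: "S \<in> sets borel" and f: "(\<lambda>x. indicator S x * f x) \<in> borel_measurable borel"
  shows integral_lebesgue_on_eq_lborel: "integral\<^sup>L (lebesgue_on S) f = (LINT x|lborel. indicator S x * f x)"
    and integrable_lebesgue_on_iff_lborel:
      "integrable (lebesgue_on S) f \<longleftrightarrow> integrable lborel (\<lambda>x. indicator S x * f x)"
  using S f by (simp_all add: integral_restrict_space integrable_restrict_space
      integral_completion integrable_completion)

text \<open>A Lebesgue measurable function agrees almost everywhere with a Borel one. Weak
  derivatives are given only up to completion, whereas Fubini for \<open>lborel\<close> wants Borel
  functions; vanishing off \<open>S\<close> is the normalisation that \<open>primitive_on\<close>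
  expects.\<close>

lemma borel_representative:
  fixes f :: "'a::euclidean_space \<Rightarrow> real"
  assumes f: "f \<in> borel_measurable (lebesgue_on S)" and S: "S \<in> sets borel"
  obtains g where "g \<in> borel_measurable borel" "\<And>x. x \<notin> S \<Longrightarrow> g x = 0"
    "AE x in lebesgue_on S. f x = g x"
proof -
  have S': "S \<in> sets lebesgue" using S by simp
  have "(\<lambda>x. if x \<in> S then f x else 0) \<in> borel_measurable lebesgue"
    by (rule borel_measurable_if_I[OF f S'])
  from completion_ex_borel_measurable_real[OF this] obtain g where
    g: "g \<in> borel_measurable borel" "AE x in lborel. (if x \<in> S then f x else 0) = g x"
    by auto
  show ?thesis
  proof
    show "(\<lambda>x. indicator S x * g x) \<in> borel_measurable borel"
      using g(1) S by simp
    have "AE x in lebesgue. x \<in> S \<longrightarrow> f x = indicator S x * g x"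
      using AE_completion[OF g(2)] by eventually_elim auto
    then show "AE x in lebesgue_on S. f x = indicator S x * g x"
      using S' by (simp add: AE_restrict_space_iff)
  qed simp
qed

lemma test_function_continuous:
  assumes "test_function D \<eta>"
  shows "continuous_on A \<eta>"
    and "b \<in> Basis \<Longrightarrow> continuous_on A (\<lambda>x. frechet_derivative \<eta> (at x) b)"
  using assms unfolding test_function_def
  by (meson continuous_on_subset differentiable_imp_continuous_on subset_UNIV)+

lemma weak_partial_cong_AE:
  assumes "weak_partial D b f g" "D \<in> sets lebesgue"
    "g \<in> borel_measurable (lebesgue_on D)" "g' \<in> borel_measurable (lebesgue_on D)"
    "AE x in lebesgue_on D. g x = g' x"
  shows "weak_partial D b f g'"
  unfolding weak_partial_def
proof (intro allI impI)
  fix \<eta> assume \<eta>: "test_function D \<eta>"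
  have [measurable]: "\<eta> \<in> borel_measurable (lebesgue_on D)"
    using continuous_imp_measurable_on_sets_lebesgue test_function_continuous(1)[OF \<eta>] assms(2) by blast
  have "(LINT x|lebesgue_on D. \<eta> x *\<^sub>R g x) = (LINT x|lebesgue_on D. \<eta> x *\<^sub>R g' x)"
    using assms(3-5) by (intro integral_cong_AE) auto
  then show "(LINT x|lebesgue_on D. frechet_derivative \<eta> (at x) b *\<^sub>R f x) =
        - (LINT x|lebesgue_on D. \<eta> x *\<^sub>R g' x)"
    using assms(1) \<eta> unfolding weak_partial_def by simp
qed

lemma test_function_has_derivative:
  fixes \<eta> :: "real \<Rightarrow> real"
  assumes "test_function D \<eta>"
  shows "(\<eta> has_real_derivative frechet_derivative \<eta> (at x) 1) (at x)"
proof -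
  have "\<eta> differentiable (at x)"
    using assms by (simp add: test_function_def differentiable_on_def)
  then have d: "(\<eta> has_derivative frechet_derivative \<eta> (at x)) (at x)"
    by (simp add: frechet_derivative_works)
  have "frechet_derivative \<eta> (at x) = (\<lambda>h. frechet_derivative \<eta> (at x) 1 * h)"
  proof
    fix h
    show "frechet_derivative \<eta> (at x) h = frechet_derivative \<eta> (at x) 1 * h"
      using linear_cmul[OF has_derivative_linear[OF d], of h 1] by (simp only: real_scaleR_def mult_1_left mult_1_right mult.commute)
  qed
  with d show ?thesis
    by (simp add: has_field_derivative_def)
qed

text \<open>Lets a test function enter the product rule as one of the factors.\<close>

lemma primitive_on_C1:
  assumes "continuous_on {a..b} f'"
    and "\<And>x. x \<in> {a..b} \<Longrightarrow> (f has_real_derivative f' x) (at x within {a..b})"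
  shows "primitive_on a b f (\<lambda>x. indicator {a..b} x * f' x)"
  unfolding primitive_on_def
proof (intro conjI ballI allI impI)
  show "integrable lborel (\<lambda>x. indicator {a..b} x * f' x)"
    using borel_integrable_atLeastAtMost'[OF assms(1)] by (simp add: set_integrable_def)
  fix t assume t: "t \<in> {a..b}"
  have "(\<integral>x. indicator {a..t} x *\<^sub>R f' x \<partial>lborel) = f t - f a"
  proof (rule integral_FTC_atLeastAtMost)
    show "continuous_on {a..t} f'"
      using t by (auto intro: continuous_on_subset[OF assms(1)])
    fix x assume "a \<le> x" "x \<le> t"
    then show "(f has_vector_derivative f' x) (at x within {a..t})"
      using assms(2)[of x] t unfolding has_real_derivative_iff_has_vector_derivative
      by (auto intro: has_vector_derivative_within_subset)
  qed (use t in auto)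
  moreover have "(LBINT u:{..t}. indicator {a..b} u * f' u) = (\<integral>x. indicator {a..t} x *\<^sub>R f' x \<partial>lborel)"
    unfolding set_lebesgue_integral_def
    using t by (intro Bochner_Integration.integral_cong) (auto simp: indicator_def)
  ultimately show "f t = f a + (LBINT u:{..t}. indicator {a..b} u * f' u)"
    by simp
qed auto

lemma test_function_zero:
  assumes "test_function D \<eta>" "x \<notin> interior D"
  shows "\<eta> x = 0"
  using assms unfolding test_function_def by blast

text \<open>By the product rule \<eta> f is again a primitive. A test function vanishes off the
  interior, hence at both endpoints, so the density of \<eta> f integrates to zero, and this is the
  weak identity.\<close>

lemma primitive_on_imp_weak_partial:
  assumes "a < b" and f: "primitive_on a b f g" and cont: "continuous_on {a..b} f"
  shows "weak_partial {a..b} 1 f g"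
  unfolding weak_partial_def
proof (intro allI impI)
  fix \<eta> :: "real \<Rightarrow> real" assume \<eta>: "test_function {a..b} \<eta>"
  let ?d = "\<lambda>x. frechet_derivative \<eta> (at x) 1"
  have cd: "continuous_on A ?d" for A
    using test_function_continuous(2)[OF \<eta>] by simp
  have g: "integrable lborel g" "\<And>x. x \<notin> {a..b} \<Longrightarrow> g x = 0"
    using f by (auto simp: primitive_on_def)
  have [measurable]: "g \<in> borel_measurable borel" "\<eta> \<in> borel_measurable borel" "?d \<in> borel_measurable borel"
    using g(1) test_function_continuous(1)[OF \<eta>] cd
    by (auto intro: borel_measurable_continuous_onI dest: borel_measurable_integrable)
  have "primitive_on a b \<eta> (\<lambda>x. indicator {a..b} x * ?d x)"
    by (intro primitive_on_C1 cd has_field_derivative_at_within[OF test_function_has_derivative[OF \<eta>]])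
  from primitive_on_mult[OF this f]
  have P: "primitive_on a b (\<lambda>t. \<eta> t * f t) (\<lambda>t. \<eta> t * g t + indicator {a..b} t * ?d t * f t)" .
  have "\<eta> a = 0" "\<eta> b = 0"
    using test_function_zero[OF \<eta>] by auto
  moreover have "\<eta> b * f b = \<eta> a * f a + (LBINT t:{..b}. \<eta> t * g t + indicator {a..b} t * ?d t * f t)"
    using P \<open>a < b\<close> unfolding primitive_on_def by (meson atLeastAtMost_iff less_imp_le order_refl)
  ultimately have "(LBINT t:{..b}. \<eta> t * g t + indicator {a..b} t * ?d t * f t) = 0"
    by simp
  also have "(LBINT t:{..b}. \<eta> t * g t + indicator {a..b} t * ?d t * f t)
      = (LBINT t. indicator {a..b} t * (\<eta> t * g t) + indicator {a..b} t * (?d t * f t))"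
    unfolding set_lebesgue_integral_def using g(2)
    by (intro Bochner_Integration.integral_cong) (auto simp: indicator_def)
  also have "\<dots> = (LBINT t. indicator {a..b} t * (\<eta> t * g t)) + (LBINT t. indicator {a..b} t * (?d t * f t))"
  proof (rule Bochner_Integration.integral_add)
    show 1: "integrable lborel (\<lambda>t. indicator {a..b} t * (?d t * f t))"
      using borel_integrable_atLeastAtMost'[OF continuous_on_mult[OF cd cont]] by (simp add: set_integrable_def)
    have 2: "integrable lborel (\<lambda>t. \<eta> t * g t + indicator {a..b} t * ?d t * f t)"
      using P by (simp only: primitive_on_def)
    \<comment> \<open>The product rule provides integrability of the sum of the two terms. One term
      is continuous on the interval, so the other is integrable as a difference.\<close>
    have "(\<lambda>t. \<eta> t * g t + indicator {a..b} t * ?d t * f t - indicator {a..b} t * (?d t * f t)) =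
        (\<lambda>t. indicator {a..b} t * (\<eta> t * g t))"
      using g(2) by (auto simp: fun_eq_iff indicator_def)
    with Bochner_Integration.integrable_diff[OF 2 1]
    show "integrable lborel (\<lambda>t. indicator {a..b} t * (\<eta> t * g t))"
      by (simp only:)
  qed
  finally have 0: "(LBINT t. indicator {a..b} t * (\<eta> t * g t)) + (LBINT t. indicator {a..b} t * (?d t * f t)) = 0" .
  have fm: "(\<lambda>t. indicator {a..b} t * (?d t * f t)) \<in> borel_measurable borel"
    using borel_measurable_continuous_on_indicator[OF _ continuous_on_mult[OF cd cont]] by simp
  have gm: "(\<lambda>t. indicator {a..b} t * (\<eta> t * g t)) \<in> borel_measurable borel"
    by measurable
  show "(LINT x|lebesgue_on {a..b}. ?d x *\<^sub>R f x) = - (LINT x|lebesgue_on {a..b}. \<eta> x *\<^sub>R g x)"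
    unfolding real_scaleR_def
      integral_lebesgue_on_eq_lborel[OF borel_closed[OF closed_atLeastAtMost] fm]
      integral_lebesgue_on_eq_lborel[OF borel_closed[OF closed_atLeastAtMost] gm]
    using 0 by linarith
qed

section \<open>Weak derivatives on an interval are classical primitives\<close>

lemma primitive_on_continuous:
  assumes "primitive_on a b f g"
  shows "continuous_on {a..b} f"
proof -
  have g: "integrable lborel g" "\<And>x. x \<notin> {a..b} \<Longrightarrow> g x = 0"
    and f: "\<And>t. t \<in> {a..b} \<Longrightarrow> f t = f a + (LBINT u:{..t}. g u)"
    using assms unfolding primitive_on_def by blast+
  have si: "set_integrable lborel A g" if "A \<in> sets borel" for A
    using that g(1) unfolding set_integrable_def by (intro integrable_mult_indicator) auto
  have *: "f a + integral {a..t} g = f t" if "t \<in> {a..b}" for t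
  proof -
    have "(LBINT u:{..t}. g u) = (LBINT u:{a..t}. g u)"
      unfolding set_lebesgue_integral_def using g(2)
      by (intro Bochner_Integration.integral_cong) (auto simp: indicator_def)
    also have "\<dots> = integral {a..t} g"
      by (rule set_borel_integral_eq_integral(2)[OF si]) simp
    finally show ?thesis using f[OF that] by simp
  qed
  have "continuous_on {a..b} (\<lambda>t. f a + integral {a..t} g)"
    by (intro continuous_intros indefinite_integral_continuous_1 set_borel_integral_eq_integral(1) si) simp
  then show ?thesis
    by (rule continuous_on_eq) (rule *)
qed

lemma integral_lebesgue_on_continuous:
  fixes f :: "real \<Rightarrow> real"
  assumes "continuous_on {a..b} f"
  shows "(LINT x|lebesgue_on {a..b}. f x) = integral {a..b} f"
  using has_integral_integral_lebesgue_on[OF continuous_imp_integrable_real[OF assms]]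
  by (simp add: integral_unique)

text \<open>The du Bois-Reymond trick: testing with a primitive of \<open>\<rho> (h - c)\<close>, where \<open>c\<close> is the
  \<open>\<rho>\<close>-weighted mean of \<open>h\<close>, gives \<open>\<integral> \<rho> (h - c)\<^sup>2 = 0\<close>.\<close>

lemma weak_partial_zero_imp_locally_constant:
  fixes h :: "real \<Rightarrow> real"
  assumes h: "continuous_on {a..b} h" and w0: "weak_partial {a..b} 1 h (\<lambda>_. 0)"
    and ab: "a < a'" "a' < b'" "b' < b"
  obtains c where "\<And>x. x \<in> {a'<..<b'} \<Longrightarrow> h x = c"
proof -
  \<comment> \<open>\<open>\<rho>\<close> is a parabola truncated at 0, positive exactly on
    \<open>{a'<..<b'}\<close>. \<open>k\<close> freezes \<open>h\<close> outside
    \<open>{a'..b'}\<close>; thus \<open>w\<close> is continuous on the whole line although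
    \<open>h\<close> is controlled on \<open>{a..b}\<close> only.\<close>
  define \<rho> where "\<rho> x = max 0 ((x - a') * (b' - x))" for x
  define k where "k x = h (max a' (min b' x))" for x
  define c where "c = integral {a..b} (\<lambda>x. \<rho> x * k x) / integral {a..b} \<rho>"
  define w where "w x = \<rho> x * (k x - c)" for x
  have c\<rho>: "continuous_on A \<rho>" for A
    unfolding \<rho>_def by (intro continuous_intros)
  have ck: "continuous_on A k" for A
    unfolding k_def using ab by (intro continuous_on_compose2[OF h] continuous_intros) auto
  have cw: "continuous_on A w" for A
    unfolding w_def by (intro continuous_intros c\<rho> ck)
  have \<rho>0: "\<rho> x = 0" if "x \<notin> {a'<..<b'}" for x
  proof -
    have "(x - a') * (b' - x) \<le> 0"
      using that ab(2) by (cases "x \<le> a'") (auto intro: mult_nonpos_nonneg mult_nonneg_nonpos)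
    then show ?thesis by (simp add: \<rho>_def)
  qed
  have \<rho>pos: "\<rho> x > 0" if "x \<in> {a'<..<b'}" for x
    using that by (auto simp: \<rho>_def less_max_iff_disj)
  have w_out: "w x = 0" if "x \<notin> {a'<..<b'}" for x
    using \<rho>0[OF that] by (simp add: w_def)
  have \<rho>int: "integral {a..b} \<rho> \<noteq> 0"
  proof
    assume "integral {a..b} \<rho> = 0"
    moreover have "\<rho> x \<ge> 0" for x by (simp add: \<rho>_def)
    ultimately have "\<forall>x\<in>{a..b}. \<rho> x = 0"
      using integral_eq_0_iff[OF c\<rho>] ab by simp
    moreover have "(a' + b') / 2 \<in> {a..b}" "(a' + b') / 2 \<in> {a'<..<b'}"
      using ab by (auto simp: field_simps)
    ultimately show False using \<rho>pos by fastforce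
  qed
  have intcont: "f integrable_on {a..b}" if "\<And>A. continuous_on A f" for f :: "real \<Rightarrow> real"
    using that by (rule integrable_continuous_real)
  have intw: "integral {a..b} w = 0"
  proof -
    have "integral {a..b} w = integral {a..b} (\<lambda>x. \<rho> x * k x - c * \<rho> x)"
      by (rule integral_cong) (simp add: w_def algebra_simps)
    also have "\<dots> = integral {a..b} (\<lambda>x. \<rho> x * k x) - c * integral {a..b} \<rho>"
      by (subst Henstock_Kurzweil_Integration.integral_diff)
         (auto intro!: intcont continuous_intros c\<rho> ck)
    finally show ?thesis using \<rho>int by (simp add: c_def)
  qed
  have "\<exists>F. \<forall>x::real. -\<infinity> < ereal x \<longrightarrow> ereal x < \<infinity> \<longrightarrow> (F has_vector_derivative w x) (at x)"
    by (rule einterval_antiderivative) (use cw[of UNIV] in \<open>auto simp: continuous_on_eq_continuous_at\<close>)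
  then obtain F where F: "\<And>x. (F has_vector_derivative w x) (at x)" by auto
  have FTC: "(w has_integral F v - F u) {u..v}" if "u \<le> v" for u v
    using fundamental_theorem_of_calculus[OF that] F has_vector_derivative_at_within by blast
  have zero_ftc: "F v = F u" if "u \<le> v" "\<And>x. x \<in> {u..v} \<Longrightarrow> w x = 0" for u v
  proof -
    have "(w has_integral 0) {u..v}"
      using that(2) by (rule has_integral_is_0)
    with FTC[OF that(1)] show ?thesis by (metis has_integral_unique eq_iff_diff_eq_0)
  qed
  \<comment> \<open>The mean value \<open>c\<close> was chosen so that \<open>w\<close> has integral
    zero. The antiderivative therefore returns to its initial value, and subtracting that value
    gives compact support.\<close>
  have Fab: "F b = F a"
    using FTC[of a b] intw ab by (simp add: has_integral_iff)
  define \<eta> where "\<eta> x = F x - F a" for x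
  have d\<eta>: "(\<eta> has_vector_derivative w x) (at x)" for x
    unfolding \<eta>_def using F[of x] by (auto intro!: derivative_eq_intros)
  have fd: "frechet_derivative \<eta> (at x) 1 = w x" for x
    using frechet_derivative_at[OF d\<eta>[unfolded has_vector_derivative_def], symmetric]
    by simp
  have \<eta>0: "\<eta> x = 0" if "x \<notin> {a'..b'}" for x
  proof (cases "x < a'")
    case True
    have "F a' = F x" "F a' = F a"
      using zero_ftc[of x a'] zero_ftc[of a a'] True ab w_out by auto
    then show ?thesis by (simp add: \<eta>_def)
  next
    case False
    then have "x \<ge> b'" using that by simp
    then have "F x = F b'" "F b = F b'"
      using zero_ftc[of b' x] zero_ftc[of b' b] ab w_out by auto
    then show ?thesis by (simp add: \<eta>_def Fab)
  qed
  have "test_function {a..b} \<eta>"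
    unfolding test_function_def
  proof (intro conjI ballI)
    show "\<eta> differentiable_on UNIV"
      using d\<eta> unfolding differentiable_on_def
      by (metis differentiableI_vector has_vector_derivative_at_within)
    show "continuous_on UNIV (\<lambda>x. frechet_derivative \<eta> (at x) i)" if "i \<in> Basis" for i :: real
      using that cw by (simp add: fd)
    show "\<exists>C. compact C \<and> C \<subseteq> interior {a..b} \<and> (\<forall>x. x \<notin> C \<longrightarrow> \<eta> x = 0)"
      using ab \<eta>0 by (intro exI[of _ "{a'..b'}"]) auto
  qed
  with w0 have "(LINT x|lebesgue_on {a..b}. w x * h x) = 0"
    unfolding weak_partial_def fd[symmetric] by simp
  then have "integral {a..b} (\<lambda>x. w x * h x) = 0"
    by (simp add: integral_lebesgue_on_continuous continuous_on_mult[OF cw h])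
  \<comment> \<open>Where \<open>\<rho>\<close> is nonzero, \<open>k\<close> and \<open>h\<close>
    coincide, and \<open>(k - c) * k\<close> equals \<open>(k - c)\<^sup>2 + c * (k - c)\<close>.
    The last summand contributes a multiple of the integral of \<open>w\<close>, which is
    zero.\<close>
  moreover have "integral {a..b} (\<lambda>x. w x * h x) = integral {a..b} (\<lambda>x. \<rho> x * (k x - c)\<^sup>2 + c * w x)"
  proof (rule integral_cong)
    fix x
    show "w x * h x = \<rho> x * (k x - c)\<^sup>2 + c * w x"
      by (cases "x \<in> {a'<..<b'}") (auto simp: w_def \<rho>0 k_def power2_eq_square algebra_simps)
  qed
  moreover have "\<dots> = integral {a..b} (\<lambda>x. \<rho> x * (k x - c)\<^sup>2) + c * integral {a..b} w"
    by (subst Henstock_Kurzweil_Integration.integral_add)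
       (auto intro!: intcont continuous_intros c\<rho> ck cw)
  ultimately have "integral {a..b} (\<lambda>x. \<rho> x * (k x - c)\<^sup>2) = 0"
    by (simp add: intw)
  moreover have "continuous_on {a..b} (\<lambda>x. \<rho> x * (k x - c)\<^sup>2)"
    by (intro continuous_intros c\<rho> ck)
  moreover have "\<rho> x * (k x - c)\<^sup>2 \<ge> 0" for x
    by (simp add: \<rho>_def)
  ultimately have sq0: "\<forall>x\<in>{a..b}. \<rho> x * (k x - c)\<^sup>2 = 0"
    using integral_eq_0_iff[of a b "\<lambda>x. \<rho> x * (k x - c)\<^sup>2"] ab by simp
  show ?thesis
  proof
    fix x assume x: "x \<in> {a'<..<b'}"
    then have "\<rho> x * (k x - c)\<^sup>2 = 0"
      using sq0 ab by auto
    then have "k x = c" using \<rho>pos[OF x] by simp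
    then show "h x = c" using x by (simp add: k_def)
  qed
qed

text \<open>Every interior point lies with the midpoint \<open>m\<close> in one inner interval that
  keeps a distance from both ends. The local constants therefore all equal \<open>h m\<close>, and
  continuity carries this value to the endpoints.\<close>

lemma weak_partial_zero_imp_constant:
  fixes h :: "real \<Rightarrow> real"
  assumes "a < b" and h: "continuous_on {a..b} h" and w0: "weak_partial {a..b} 1 h (\<lambda>_. 0)"
    and "x \<in> {a..b}"
  shows "h x = h a"
proof -
  define m where "m = (a + b) / 2"
  have m: "a < m" "m < b" using \<open>a < b\<close> by (auto simp: m_def)
  have inner: "h y = h m" if y: "y \<in> {a<..<b}" for y
  proof -
    define a' b' where "a' = (a + min y m) / 2" and "b' = (b + max y m) / 2"
    have ab: "a < a'" "a' < b'" "b' < b" and in': "y \<in> {a'<..<b'}" "m \<in> {a'<..<b'}"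
      using y m by (auto simp: a'_def b'_def min_def max_def field_simps)
    from weak_partial_zero_imp_locally_constant[OF h w0 ab]
    obtain c where "\<And>x. x \<in> {a'<..<b'} \<Longrightarrow> h x = c" by blast
    with in' show ?thesis by metis
  qed
  have cl: "closure {a<..<b} = {a..b}"
    using \<open>a < b\<close> by simp
  have "h y = h m" if "y \<in> {a..b}" for y
    using continuous_constant_on_closure[of "{a<..<b}" h "h m" y] h inner that
    unfolding cl by blast
  then show ?thesis using assms(4) \<open>a < b\<close> by (metis atLeastAtMost_iff less_imp_le order_refl)
qed

text \<open>Subtracting the primitive \<open>G\<close> of \<open>g\<close> leaves a continuous
  function with weak derivative zero, which is constant.\<close>

lemma weak_partial_imp_primitive_on:
  fixes f g :: "real \<Rightarrow> real"
  assumes "a < b" and f: "continuous_on {a..b} f" and w: "weak_partial {a..b} 1 f g"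
    and g: "integrable lborel g" and g0: "\<And>x. x \<notin> {a..b} \<Longrightarrow> g x = 0"
  shows "primitive_on a b f g"
proof -
  define G where "G t = (LBINT u:{..t}. g u)" for t
  \<comment> \<open>\<open>g\<close> vanishes to the left of \<open>a\<close>, and the point
    \<open>a\<close> itself has measure zero.\<close>
  have Ga: "G a = 0"
  proof -
    have "G a = integral\<^sup>L lborel (\<lambda>u::real. 0::real)"
      unfolding G_def set_lebesgue_integral_def
    proof (rule integral_cong_AE)
      show "AE u in lborel. indicat_real {..a} u *\<^sub>R g u = 0"
        using AE_lborel_singleton[of a] by eventually_elim (auto simp: indicator_def g0)
    qed (use borel_measurable_integrable[OF g] in auto)
    then show ?thesis by simp
  qed
  have PG: "primitive_on a b G g"
    unfolding primitive_on_def using g g0 by (auto simp: Ga) (simp add: G_def)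
  note cG = primitive_on_continuous[OF PG]
  have wG: "weak_partial {a..b} 1 G g"
    by (rule primitive_on_imp_weak_partial[OF \<open>a < b\<close> PG cG])
  have "weak_partial {a..b} 1 (\<lambda>t. f t - G t) (\<lambda>_. 0)"
    unfolding weak_partial_def
  proof (intro allI impI)
    fix \<eta> :: "real \<Rightarrow> real" assume \<eta>: "test_function {a..b} \<eta>"
    have cd: "continuous_on {a..b} (\<lambda>x. frechet_derivative \<eta> (at x) 1)"
      using test_function_continuous(2)[OF \<eta>] by simp
    have "(LINT x|lebesgue_on {a..b}. frechet_derivative \<eta> (at x) 1 *\<^sub>R (f x - G x)) =
        (LINT x|lebesgue_on {a..b}. frechet_derivative \<eta> (at x) 1 *\<^sub>R f x) -
        (LINT x|lebesgue_on {a..b}. frechet_derivative \<eta> (at x) 1 *\<^sub>R G x)"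
      unfolding scaleR_diff_right
      by (intro Bochner_Integration.integral_diff continuous_imp_integrable_real continuous_intros cd f cG)
    then show "(LINT x|lebesgue_on {a..b}. frechet_derivative \<eta> (at x) 1 *\<^sub>R (f x - G x)) =
        - (LINT x|lebesgue_on {a..b}. \<eta> x *\<^sub>R 0)"
      using w wG \<eta> unfolding weak_partial_def by simp
  qed
  then have const: "f t - G t = f a - G a" if "t \<in> {a..b}" for t
    using weak_partial_zero_imp_constant[OF \<open>a < b\<close> _ _ that] f cG by (blast intro: continuous_on_diff)
  show ?thesis
    unfolding primitive_on_def
  proof (intro conjI ballI allI impI)
    fix t assume "t \<in> {a..b}"
    from const[OF this] show "f t = f a + (LBINT u:{..t}. g u)"
      by (simp add: Ga) (simp add: G_def)
  qed (use g g0 in auto)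
qed

section \<open>Closure properties of the Lebesgue and Sobolev spaces\<close>

lemma norm_square_eq_sum_Basis:
  fixes x :: "'a::euclidean_space"
  shows "(norm x)\<^sup>2 = (\<Sum>i\<in>Basis. (x \<bullet> i)\<^sup>2)"
  unfolding power2_norm_eq_inner by (subst euclidean_inner) (simp add: power2_eq_square)

lemma L2_D:
  assumes "f \<in> L2 D"
  shows "f \<in> borel_measurable (lebesgue_on D)" "integrable (lebesgue_on D) (\<lambda>x. (norm (f x))\<^sup>2)"
  using assms by (auto simp: L2_def)

lemma L2_componentwise_iff:
  "f \<in> L2 D \<longleftrightarrow> (\<forall>i\<in>Basis. (\<lambda>x. f x \<bullet> i) \<in> L2 D)"
proof safe
  fix i :: 'b assume f: "f \<in> L2 D" and i: "i \<in> Basis"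
  note [measurable] = L2_D(1)[OF f]
  have "integrable (lebesgue_on D) (\<lambda>x. (norm (f x \<bullet> i))\<^sup>2)"
  proof (rule Bochner_Integration.integrable_bound[OF L2_D(2)[OF f]])
    show "AE x in lebesgue_on D. norm ((norm (f x \<bullet> i))\<^sup>2) \<le> norm ((norm (f x))\<^sup>2)"
      using power_mono[OF Basis_le_norm[OF i] abs_ge_zero, where n=2] by (intro AE_I2) simp
  qed measurable
  then show "(\<lambda>x. f x \<bullet> i) \<in> L2 D" by (simp add: L2_def)
next
  assume f: "\<forall>i\<in>Basis. (\<lambda>x. f x \<bullet> i) \<in> L2 D"
  have "f \<in> borel_measurable (lebesgue_on D)"
    by (subst borel_measurable_euclidean_space) (use f L2_D(1) in blast)
  moreover have "integrable (lebesgue_on D) (\<lambda>x. (norm (f x))\<^sup>2)"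
    unfolding norm_square_eq_sum_Basis
  proof (rule Bochner_Integration.integrable_sum)
    fix i :: 'b assume "i \<in> Basis"
    then show "integrable (lebesgue_on D) (\<lambda>x. (f x \<bullet> i)\<^sup>2)"
      using f L2_D(2)[of "\<lambda>x. f x \<bullet> i" D] by simp
  qed
  ultimately show "f \<in> L2 D" by (simp add: L2_def)
qed

lemma L2_add:
  fixes f g :: "'a::euclidean_space \<Rightarrow> 'b::euclidean_space"
  assumes f: "f \<in> L2 D" and g: "g \<in> L2 D"
  shows "(\<lambda>x. f x + g x) \<in> L2 D"
proof -
  note [measurable] = L2_D(1)[OF f] L2_D(1)[OF g]
  have "integrable (lebesgue_on D) (\<lambda>x. (norm (f x + g x))\<^sup>2)"
  proof (rule Bochner_Integration.integrable_bound)
    show "integrable (lebesgue_on D) (\<lambda>x. 2 * (norm (f x))\<^sup>2 + 2 * (norm (g x))\<^sup>2)"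
      using L2_D(2)[OF f] L2_D(2)[OF g] by simp
    have "(norm (u + v))\<^sup>2 \<le> 2 * (norm u)\<^sup>2 + 2 * (norm v)\<^sup>2" for u v :: 'b
    proof -
      have "(norm (u + v))\<^sup>2 \<le> (norm u + norm v)\<^sup>2"
        by (simp add: norm_triangle_ineq power_mono)
      also have "\<dots> \<le> 2 * (norm u)\<^sup>2 + 2 * (norm v)\<^sup>2"
        using sum_squares_bound[of "norm u" "norm v"] by (simp add: power2_sum)
      finally show ?thesis .
    qed
    then show "AE x in lebesgue_on D. norm ((norm (f x + g x))\<^sup>2) \<le> norm (2 * (norm (f x))\<^sup>2 + 2 * (norm (g x))\<^sup>2)"
      by (intro AE_I2) auto
  qed measurable
  then show ?thesis by (simp add: L2_def)
qed

lemma L2_zero: "(\<lambda>x. 0) \<in> L2 D"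
  by (simp add: L2_def)

lemma L2_sum:
  "(\<And>i. i \<in> A \<Longrightarrow> f i \<in> L2 D) \<Longrightarrow> (\<lambda>x. \<Sum>i\<in>A. f i x) \<in> L2 D"
  by (induction A rule: infinite_finite_induct) (auto intro: L2_add L2_zero)

lemma continuous_on_compact_bound:
  fixes f :: "'a::topological_space \<Rightarrow> 'b::real_normed_vector"
  assumes "compact D" "continuous_on D f"
  obtains M where "0 \<le> M" "\<And>x. x \<in> D \<Longrightarrow> norm (f x) \<le> M"
proof -
  obtain M where "\<forall>x\<in>D. norm (f x) \<le> M"
    using compact_imp_bounded[OF compact_continuous_image[OF assms(2,1)]] by (auto simp: bounded_iff)
  then show ?thesis by (intro that[of "max M 0"]) auto
qed

lemma compact_sets_lebesgue: "compact D \<Longrightarrow> D \<in> sets lebesgue"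
  by (simp add: borel_compact)

lemma finite_measure_lebesgue_on_compact: "compact D \<Longrightarrow> finite_measure (lebesgue_on D)"
  by (rule finite_measure_lebesgue_on[OF lmeasurable_compact])

lemma L2_continuous_scaleR:
  fixes f :: "'a::euclidean_space \<Rightarrow> real" and g :: "'a \<Rightarrow> 'b::euclidean_space"
  assumes D: "compact D" and f: "continuous_on D f" and g: "g \<in> L2 D"
  shows "(\<lambda>x. f x *\<^sub>R g x) \<in> L2 D"
proof -
  obtain M where M: "0 \<le> M" "\<And>x. x \<in> D \<Longrightarrow> norm (f x) \<le> M"
    using continuous_on_compact_bound[OF D f] by metis
  have [measurable]: "f \<in> borel_measurable (lebesgue_on D)" "g \<in> borel_measurable (lebesgue_on D)"
    using continuous_imp_measurable_on_sets_lebesgue[OF f] D L2_D(1)[OF g]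
    by (auto simp: compact_sets_lebesgue)
  have "integrable (lebesgue_on D) (\<lambda>x. (norm (f x *\<^sub>R g x))\<^sup>2)"
  proof (rule Bochner_Integration.integrable_bound)
    show "integrable (lebesgue_on D) (\<lambda>x. M\<^sup>2 * (norm (g x))\<^sup>2)"
      using L2_D(2)[OF g] by simp
    have "(norm (f x *\<^sub>R g x))\<^sup>2 \<le> M\<^sup>2 * (norm (g x))\<^sup>2" if "x \<in> D" for x
      using power_mono[OF M(2)[OF that], of 2] by (simp add: power_mult_distrib mult_right_mono)
    then show "AE x in lebesgue_on D. norm ((norm (f x *\<^sub>R g x))\<^sup>2) \<le> norm (M\<^sup>2 * (norm (g x))\<^sup>2)"
      by (intro AE_I2) auto
  qed measurable
  then show ?thesis by (simp add: L2_def)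
qed

lemma L2_mult_continuous:
  fixes f g :: "'a::euclidean_space \<Rightarrow> real"
  assumes "compact D" "continuous_on D f" "g \<in> L2 D"
  shows "(\<lambda>x. f x * g x) \<in> L2 D"
  using L2_continuous_scaleR[OF assms] by simp

lemma L2_const: "compact D \<Longrightarrow> (\<lambda>x. c) \<in> L2 D"
  by (simp add: L2_def finite_measure.integrable_const[OF finite_measure_lebesgue_on_compact])

lemma L2_continuous:
  fixes f :: "'a::euclidean_space \<Rightarrow> real"
  shows "compact D \<Longrightarrow> continuous_on D f \<Longrightarrow> f \<in> L2 D"
  using L2_mult_continuous[of D f "\<lambda>x. 1"] by (simp add: L2_const)

text \<open>On a set of finite measure \<open>1 + (norm (f x))\<^sup>2\<close> is an integrable
  majorant. Integrability matters throughout because the integral of a non-integrable function has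
  the default value 0 and then need not be additive.\<close>

lemma L2_imp_integrable:
  fixes f :: "'a::euclidean_space \<Rightarrow> 'b::euclidean_space"
  assumes D: "compact D" and f: "f \<in> L2 D"
  shows "integrable (lebesgue_on D) f"
proof (rule Bochner_Integration.integrable_bound)
  interpret finite_measure "lebesgue_on D" by (rule finite_measure_lebesgue_on_compact[OF D])
  show "integrable (lebesgue_on D) (\<lambda>x. 1 + (norm (f x))\<^sup>2)"
    using L2_D(2)[OF f] by simp
  have "t \<le> 1 + t\<^sup>2" for t :: real
    using sum_squares_bound[of t 1, simplified] zero_le_power2[of t] by linarith
  then show "AE x in lebesgue_on D. norm (f x) \<le> norm (1 + (norm (f x))\<^sup>2)"
    by (intro AE_I2) auto
qed (rule L2_D(1)[OF f])

lemma L2_cong: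
  assumes "\<And>x. x \<in> D \<Longrightarrow> f x = g x" shows "f \<in> L2 D \<longleftrightarrow> g \<in> L2 D"
proof -
  have "integrable (lebesgue_on D) (\<lambda>x. (norm (f x))\<^sup>2) \<longleftrightarrow> integrable (lebesgue_on D) (\<lambda>x. (norm (g x))\<^sup>2)"
    using assms by (intro Bochner_Integration.integrable_cong) auto
  then show ?thesis
    using measurable_lebesgue_cong[of D f g borel] assms by (auto simp: L2_def)
qed

lemma integrable_continuous_scaleR_L2:
  fixes f :: "'a::euclidean_space \<Rightarrow> 'b::euclidean_space"
  assumes "compact D" "continuous_on D h" "f \<in> L2 D"
  shows "integrable (lebesgue_on D) (\<lambda>x. h x *\<^sub>R f x)"
  by (rule L2_imp_integrable[OF assms(1) L2_continuous_scaleR[OF assms]])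

section \<open>Weak derivatives under sums, linear maps and products\<close>

lemma W2_D:
  assumes "f \<in> W2 D"
  shows "continuous_on D f" "f \<in> L2 D"
    "b \<in> Basis \<Longrightarrow> \<exists>g\<in>L2 D. weak_partial D b f g"
  using assms by (auto simp: W2_def)

lemma weak_partial_cong:
  assumes "\<And>x. x \<in> D \<Longrightarrow> f x = f' x"
  shows "weak_partial D b f g \<longleftrightarrow> weak_partial D b f' g"
proof -
  have "(LINT x|lebesgue_on D. h x *\<^sub>R f x) = (LINT x|lebesgue_on D. h x *\<^sub>R f' x)" for h :: "'a \<Rightarrow> real"
    using assms by (intro Bochner_Integration.integral_cong) auto
  then show ?thesis unfolding weak_partial_def by simp
qed

text \<open>The components produced by \<open>P_op\<close> are defined by cases. Membership depends
  only on values in \<open>D\<close>, so there they may be replaced by the formula of the first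
  case.\<close>

lemma W2_cong:
  assumes "\<And>x. x \<in> D \<Longrightarrow> f x = f' x"
  shows "f \<in> W2 D \<longleftrightarrow> f' \<in> W2 D"
proof -
  have "continuous_on D f \<longleftrightarrow> continuous_on D f'"
    using assms by (intro continuous_on_cong) auto
  then show ?thesis
    unfolding W2_def using L2_cong[of D f f'] weak_partial_cong[of D f f'] assms by auto
qed

lemma W2_add:
  fixes f g :: "'a::euclidean_space \<Rightarrow> 'b::euclidean_space"
  assumes D: "compact D" and f: "f \<in> W2 D" and g: "g \<in> W2 D"
  shows "(\<lambda>x. f x + g x) \<in> W2 D"
  unfolding W2_def
proof (intro CollectI conjI ballI)
  fix b :: 'a assume b: "b \<in> Basis"
  obtain f' g' where f': "f' \<in> L2 D" "weak_partial D b f f'" and g': "g' \<in> L2 D" "weak_partial D b g g'"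
    using W2_D(3)[OF f b] W2_D(3)[OF g b] by blast
  have "weak_partial D b (\<lambda>x. f x + g x) (\<lambda>x. f' x + g' x)"
    unfolding weak_partial_def
  proof (intro allI impI)
    fix \<eta> assume \<eta>: "test_function D \<eta>"
    note int = integrable_continuous_scaleR_L2[OF D test_function_continuous(2)[OF \<eta> b]]
      integrable_continuous_scaleR_L2[OF D test_function_continuous(1)[OF \<eta>]]
    show "(LINT x|lebesgue_on D. frechet_derivative \<eta> (at x) b *\<^sub>R (f x + g x)) =
        - (LINT x|lebesgue_on D. \<eta> x *\<^sub>R (f' x + g' x))"
      using f'(2) g'(2) \<eta> unfolding weak_partial_def scaleR_add_right
      by (simp add: int f'(1) g'(1) W2_D(2)[OF f] W2_D(2)[OF g])
  qed
  with L2_add[OF f'(1) g'(1)] show "\<exists>k\<in>L2 D. weak_partial D b (\<lambda>x. f x + g x) k" by blast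
qed (use W2_D[OF f] W2_D[OF g] in \<open>auto intro: continuous_on_add L2_add\<close>)

lemma W2_zero: "(\<lambda>x. 0) \<in> W2 D"
  by (auto simp: W2_def L2_zero weak_partial_def intro!: bexI[of _ "\<lambda>x. 0"])

lemma W2_sum:
  assumes "compact D" "\<And>i. i \<in> A \<Longrightarrow> f i \<in> W2 D"
  shows "(\<lambda>x. \<Sum>i\<in>A. f i x) \<in> W2 D"
  using assms(2) by (induction A rule: infinite_finite_induct) (auto intro: W2_add[OF assms(1)] W2_zero)

text \<open>A bounded linear map commutes with the integral, so it carries a weak derivative along.
  It is applied to scalar factors, to matrix entries, and to the map from a matrix to its transpose
  acting on a fixed vector.\<close>

lemma W2_bounded_linear:
  fixes f :: "'a::euclidean_space \<Rightarrow> 'b::euclidean_space" and T :: "'b \<Rightarrow> 'c::euclidean_space"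
  assumes D: "compact D" and f: "f \<in> W2 D" and T: "bounded_linear T"
  shows "(\<lambda>x. T (f x)) \<in> W2 D"
proof -
  have L2T: "(\<lambda>x. T (h x)) \<in> L2 D" if h: "h \<in> L2 D" for h :: "'a \<Rightarrow> 'b"
  proof -
    note [measurable] = L2_D(1)[OF h]
    have Tm[measurable]: "T \<in> borel_measurable borel"
      using T by (intro borel_measurable_continuous_onI linear_continuous_on)
    obtain M where M: "0 \<le> M" "\<And>x. norm (T x) \<le> norm x * M"
      using bounded_linear.nonneg_bounded[OF T] by blast
    have "integrable (lebesgue_on D) (\<lambda>x. (norm (T (h x)))\<^sup>2)"
    proof (rule Bochner_Integration.integrable_bound)
      show "integrable (lebesgue_on D) (\<lambda>x. (norm (h x))\<^sup>2 * M\<^sup>2)"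
        using L2_D(2)[OF h] by simp
      show "AE x in lebesgue_on D. norm ((norm (T (h x)))\<^sup>2) \<le> norm ((norm (h x))\<^sup>2 * M\<^sup>2)"
        using power_mono[OF M(2) norm_ge_zero, where n=2] by (intro AE_I2) (simp add: power_mult_distrib)
    qed measurable
    moreover have "(\<lambda>x. T (h x)) \<in> borel_measurable (lebesgue_on D)" by measurable
    ultimately show ?thesis by (simp add: L2_def)
  qed
  show ?thesis
    unfolding W2_def
  proof (intro CollectI conjI ballI)
    show "continuous_on D (\<lambda>x. T (f x))"
      using bounded_linear.continuous_on[OF T W2_D(1)[OF f]] .
    fix b :: 'a assume b: "b \<in> Basis"
    obtain g where g: "g \<in> L2 D" "weak_partial D b f g"
      using W2_D(3)[OF f b] by blast
    have "weak_partial D b (\<lambda>x. T (f x)) (\<lambda>x. T (g x))"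
      unfolding weak_partial_def
    proof (intro allI impI)
      fix \<eta> assume \<eta>: "test_function D \<eta>"
      note int = integrable_continuous_scaleR_L2[OF D test_function_continuous(2)[OF \<eta> b] W2_D(2)[OF f]]
        integrable_continuous_scaleR_L2[OF D test_function_continuous(1)[OF \<eta>] g(1)]
      have sc: "c *\<^sub>R T x = T (c *\<^sub>R x)" for c x
        using linear_cmul[OF bounded_linear.linear[OF T]] by simp
      have "T (LINT x|lebesgue_on D. frechet_derivative \<eta> (at x) b *\<^sub>R f x) =
          - T (LINT x|lebesgue_on D. \<eta> x *\<^sub>R g x)"
        using g(2) \<eta> linear_neg[OF bounded_linear.linear[OF T]] unfolding weak_partial_def by simp
      then show "(LINT x|lebesgue_on D. frechet_derivative \<eta> (at x) b *\<^sub>R T (f x)) =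
          - (LINT x|lebesgue_on D. \<eta> x *\<^sub>R T (g x))"
        unfolding sc by (simp add: integral_bounded_linear[OF T] int)
    qed
    with L2T[OF g(1)] show "\<exists>k\<in>L2 D. weak_partial D b (\<lambda>x. T (f x)) k" by blast
  qed (rule L2T[OF W2_D(2)[OF f]])
qed

lemma W2_componentwise:
  fixes f :: "'a::euclidean_space \<Rightarrow> 'b::euclidean_space"
  assumes D: "compact D" and f: "\<And>i. i \<in> Basis \<Longrightarrow> (\<lambda>x. f x \<bullet> i) \<in> W2 D"
  shows "f \<in> W2 D"
proof -
  have "(\<lambda>x. \<Sum>i\<in>Basis. (f x \<bullet> i) *\<^sub>R i) \<in> W2 D"
    by (intro W2_sum[OF D] W2_bounded_linear[OF D f] bounded_linear_scaleR_left)
  then show ?thesis by (simp add: euclidean_representation)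
qed

text \<open>Bridge between the definition by test functions and the classical description by
  densities. The only gap left is the choice of representative: the weak derivative is replaced by a
  Borel function that vanishes off the interval before it can serve as a density.\<close>

lemma W2_real_interval_iff:
  fixes f :: "real \<Rightarrow> real"
  assumes "a < b"
  shows "f \<in> W2 {a..b} \<longleftrightarrow> (\<exists>g. primitive_on a b f g \<and> integrable lborel (\<lambda>x. (g x)\<^sup>2))"
proof
  assume f: "f \<in> W2 {a..b}"
  obtain g where g: "g \<in> L2 {a..b}" "weak_partial {a..b} 1 f g"
    using W2_D(3)[OF f, of 1] by auto
  obtain g' where g': "g' \<in> borel_measurable borel" "\<And>x. x \<notin> {a..b} \<Longrightarrow> g' x = 0"
    "AE x in lebesgue_on {a..b}. g x = g' x"
    using borel_representative[OF L2_D(1)[OF g(1)]] by auto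
  have ind: "(\<lambda>x. indicator {a..b} x * g' x) = g'" "(\<lambda>x. indicator {a..b} x * (g' x)\<^sup>2) = (\<lambda>x. (g' x)\<^sup>2)"
    using g'(2) by (auto simp: fun_eq_iff indicator_def)
  have gm: "g' \<in> borel_measurable (lebesgue_on {a..b})"
    using g'(1) by (intro measurable_restrict_space1 measurable_completion) simp
  have "integrable (lebesgue_on {a..b}) g'"
    using L2_imp_integrable[OF compact_Icc g(1)] gm g'(3) L2_D(1)[OF g(1)]
    by (subst integrable_cong_AE[of _ _ g]) auto
  then have 1: "integrable lborel g'"
    using g'(1) by (subst (asm) integrable_lebesgue_on_iff_lborel) (auto simp: ind)
  have "integrable (lebesgue_on {a..b}) (\<lambda>x. (g' x)\<^sup>2)"
    using L2_D[OF g(1)] gm g'(3)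
    by (subst integrable_cong_AE[of _ _ "\<lambda>x. (norm (g x))\<^sup>2"]) auto
  then have 2: "integrable lborel (\<lambda>x. (g' x)\<^sup>2)"
    using g'(1) by (subst (asm) integrable_lebesgue_on_iff_lborel) (auto simp: ind)
  have "weak_partial {a..b} 1 f g'"
    using g'(3) gm L2_D(1)[OF g(1)] by (intro weak_partial_cong_AE[OF g(2)]) auto
  from weak_partial_imp_primitive_on[OF assms W2_D(1)[OF f] this 1 g'(2)] 2
  show "\<exists>g. primitive_on a b f g \<and> integrable lborel (\<lambda>x. (g x)\<^sup>2)" by blast
next
  assume "\<exists>g. primitive_on a b f g \<and> integrable lborel (\<lambda>x. (g x)\<^sup>2)"
  then obtain g where g: "primitive_on a b f g" "integrable lborel (\<lambda>x. (g x)\<^sup>2)" by blast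
  have g0: "integrable lborel g" "\<And>x. x \<notin> {a..b} \<Longrightarrow> g x = 0"
    using g(1) unfolding primitive_on_def by blast+
  have [measurable]: "g \<in> borel_measurable borel"
    using borel_measurable_integrable[OF g0(1)] by simp
  have ind: "(\<lambda>x. indicator {a..b} x * (g x)\<^sup>2) = (\<lambda>x. (g x)\<^sup>2)"
    using g0(2) by (auto simp: fun_eq_iff indicator_def)
  have "integrable (lebesgue_on {a..b}) (\<lambda>x. (g x)\<^sup>2)"
    using g(2) by (subst integrable_lebesgue_on_iff_lborel) (auto simp: ind)
  moreover have "g \<in> borel_measurable (lebesgue_on {a..b})"
    by (intro measurable_restrict_space1 measurable_completion) simp
  ultimately have "g \<in> L2 {a..b}" by (simp add: L2_def)
  moreover note c = primitive_on_continuous[OF g(1)]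
  moreover have "weak_partial {a..b} 1 f g"
    by (rule primitive_on_imp_weak_partial[OF assms g(1) c])
  ultimately show "f \<in> W2 {a..b}"
    unfolding W2_def by (auto intro: L2_continuous)
qed

text \<open>The product rule supplies the density \<open>f t * k t + g t * h t\<close>. It is square
  integrable because \<open>f\<close> and \<open>h\<close>, being continuous on a compact interval,
  are bounded there by \<open>M\<close> and \<open>N\<close>.\<close>

lemma W2_mult:
  fixes f h :: "real \<Rightarrow> real"
  assumes "a < b" and f: "f \<in> W2 {a..b}" and h: "h \<in> W2 {a..b}"
  shows "(\<lambda>x. f x * h x) \<in> W2 {a..b}"
proof -
  obtain g k where g: "primitive_on a b f g" "integrable lborel (\<lambda>x. (g x)\<^sup>2)"
    and k: "primitive_on a b h k" "integrable lborel (\<lambda>x. (k x)\<^sup>2)"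
    using f h unfolding W2_real_interval_iff[OF \<open>a < b\<close>] by blast
  have P: "primitive_on a b (\<lambda>t. f t * h t) (\<lambda>t. f t * k t + g t * h t)"
    by (rule primitive_on_mult[OF g(1) k(1)])
  obtain M N where M: "\<And>x. x \<in> {a..b} \<Longrightarrow> norm (f x) \<le> M" and N: "\<And>x. x \<in> {a..b} \<Longrightarrow> norm (h x) \<le> N"
    using continuous_on_compact_bound[OF compact_Icc W2_D(1)[OF f]]
      continuous_on_compact_bound[OF compact_Icc W2_D(1)[OF h]] by metis
  have out: "g x = 0" "k x = 0" if "x \<notin> {a..b}" for x
    using that g(1) k(1) unfolding primitive_on_def by blast+
  have "integrable lborel (\<lambda>t. (f t * k t + g t * h t)\<^sup>2)"
  proof (rule Bochner_Integration.integrable_bound)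
    show "integrable lborel (\<lambda>t. 2 * (M\<^sup>2 * (k t)\<^sup>2) + 2 * (N\<^sup>2 * (g t)\<^sup>2))"
      using g(2) k(2) by simp
    have "(\<lambda>t. f t * k t + g t * h t) \<in> borel_measurable lborel"
      using P by (auto simp: primitive_on_def dest: borel_measurable_integrable)
    then show "(\<lambda>t. (f t * k t + g t * h t)\<^sup>2) \<in> borel_measurable lborel" by simp
    have "(f t * k t + g t * h t)\<^sup>2 \<le> 2 * (M\<^sup>2 * (k t)\<^sup>2) + 2 * (N\<^sup>2 * (g t)\<^sup>2)" for t
    proof (cases "t \<in> {a..b}")
      case True
      have "(f t * k t + g t * h t)\<^sup>2 \<le> 2 * (f t * k t)\<^sup>2 + 2 * (g t * h t)\<^sup>2"
        using sum_squares_bound[of "f t * k t" "g t * h t"] by (simp add: power2_sum)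
      also have "(f t * k t)\<^sup>2 \<le> M\<^sup>2 * (k t)\<^sup>2"
        using power_mono[OF M[OF True], of 2] by (simp add: power_mult_distrib mult_right_mono)
      also have "(g t * h t)\<^sup>2 \<le> N\<^sup>2 * (g t)\<^sup>2"
        using mult_left_mono[OF power_mono[OF N[OF True] norm_ge_zero, where n=2] zero_le_power2[of "g t"]]
        by (simp add: power_mult_distrib mult.commute)
      finally show ?thesis by simp
    qed (simp add: out)
    then show "AE t in lborel. norm ((f t * k t + g t * h t)\<^sup>2) \<le> norm (2 * (M\<^sup>2 * (k t)\<^sup>2) + 2 * (N\<^sup>2 * (g t)\<^sup>2))"
      by (intro AE_I2) auto
  qed
  with P show ?thesis
    unfolding W2_real_interval_iff[OF \<open>a < b\<close>] by blast
qed

section \<open>Integral operators with Sobolev kernels\<close>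

text \<open>Cauchy-Schwarz against the constant 1, obtained from the nonnegativity of the variance
  with \<open>m\<close> the mean of \<open>u\<close>. The mean divides by the total mass, so the
  null measure is treated separately.\<close>

lemma (in finite_measure) square_integral_le:
  fixes u :: "'a \<Rightarrow> real"
  assumes u: "integrable M u" and u2: "integrable M (\<lambda>x. (u x)\<^sup>2)"
  shows "(\<integral>x. u x \<partial>M)\<^sup>2 \<le> measure M (space M) * (\<integral>x. (u x)\<^sup>2 \<partial>M)"
proof (cases "measure M (space M) = 0")
  case True
  then have "AE x in M. False"
    by (intro AE_I[of _ _ "space M"]) (auto simp: emeasure_eq_measure)
  then have "(\<integral>x. u x \<partial>M) = (\<integral>x. 0 \<partial>M)"
    using u by (intro integral_cong_AE) auto
  then show ?thesis using True by simp
next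
  case False
  define \<mu> where "\<mu> = measure M (space M)"
  have \<mu>: "\<mu> > 0" using False measure_nonneg[of M "space M"] by (simp add: \<mu>_def less_le)
  define m where "m = (\<integral>x. u x \<partial>M) / \<mu>"
  have "0 \<le> (\<integral>x. (u x - m)\<^sup>2 \<partial>M)"
    by (rule integral_nonneg_AE) simp
  also have "\<dots> = (\<integral>x. (u x)\<^sup>2 + (m\<^sup>2 - 2 * m * u x) \<partial>M)"
    by (rule Bochner_Integration.integral_cong) (auto simp: power2_eq_square algebra_simps)
  also have "\<dots> = (\<integral>x. (u x)\<^sup>2 \<partial>M) + (m\<^sup>2 * \<mu> - 2 * m * (\<integral>x. u x \<partial>M))"
    using u u2 by (simp add: \<mu>_def)
  also have "m\<^sup>2 * \<mu> - 2 * m * (\<integral>x. u x \<partial>M) = - ((\<integral>x. u x \<partial>M)\<^sup>2 / \<mu>)"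
    using \<mu> by (simp add: m_def power2_eq_square field_simps)
  finally have "(\<integral>x. u x \<partial>M)\<^sup>2 / \<mu> \<le> (\<integral>x. (u x)\<^sup>2 \<partial>M)" by simp
  then show ?thesis using \<mu> by (simp add: \<mu>_def field_simps)
qed

text \<open>Dominated convergence along sequences: on the compact product \<open>k\<close> is
  bounded by some \<open>M\<close>, and \<open>M * norm (\<phi> \<theta>)\<close> is a majorant
  independent of the parameter.\<close>

lemma continuous_on_integral_operator:
  fixes k :: "'a::metric_space \<times> 'b::euclidean_space \<Rightarrow> real"
  assumes I: "compact I" and J: "compact J" and k: "continuous_on (I \<times> J) k"
    and \<phi>: "integrable (lebesgue_on J) \<phi>"
  shows "continuous_on I (\<lambda>s. LINT \<theta>|lebesgue_on J. k (s, \<theta>) * \<phi> \<theta>)"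
  unfolding continuous_on_sequentially
proof (intro allI ballI impI, elim conjE)
  fix s and sq :: "nat \<Rightarrow> 'a"
  assume s: "s \<in> I" and sq: "\<forall>n. sq n \<in> I" "sq \<longlonglongrightarrow> s"
  obtain M where M: "0 \<le> M" "\<And>z. z \<in> I \<times> J \<Longrightarrow> norm (k z) \<le> M"
    using continuous_on_compact_bound[OF compact_Times[OF I J] k] by metis
  have km: "(\<lambda>\<theta>. k (t, \<theta>) * \<phi> \<theta>) \<in> borel_measurable (lebesgue_on J)" if "t \<in> I" for t
  proof -
    have "continuous_on J (\<lambda>\<theta>. k (t, \<theta>))"
      using that by (intro continuous_on_compose2[OF k] continuous_intros) auto
    from continuous_imp_measurable_on_sets_lebesgue[OF this compact_sets_lebesgue[OF J]]
    show ?thesis using borel_measurable_integrable[OF \<phi>] by simp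
  qed
  have "(\<lambda>n. LINT \<theta>|lebesgue_on J. k (sq n, \<theta>) * \<phi> \<theta>) \<longlonglongrightarrow> (LINT \<theta>|lebesgue_on J. k (s, \<theta>) * \<phi> \<theta>)"
  proof (rule integral_dominated_convergence)
    show "integrable (lebesgue_on J) (\<lambda>\<theta>. M * norm (\<phi> \<theta>))"
      using \<phi> by simp
    have "(\<lambda>n. k (sq n, \<theta>) * \<phi> \<theta>) \<longlonglongrightarrow> k (s, \<theta>) * \<phi> \<theta>" if "\<theta> \<in> J" for \<theta>
    proof -
      have "(\<lambda>n. (sq n, \<theta>)) \<longlonglongrightarrow> (s, \<theta>)"
        using sq(2) by (intro tendsto_Pair tendsto_const)
      then have "(\<lambda>n. k (sq n, \<theta>)) \<longlonglongrightarrow> k (s, \<theta>)"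
        using k[unfolded continuous_on_sequentially, rule_format, of "(s, \<theta>)" "\<lambda>n. (sq n, \<theta>)"] s sq that
        by (auto simp: o_def)
      then show ?thesis by (intro tendsto_intros)
    qed
    then show "AE \<theta> in lebesgue_on J. (\<lambda>n. k (sq n, \<theta>) * \<phi> \<theta>) \<longlonglongrightarrow> k (s, \<theta>) * \<phi> \<theta>"
      by (intro AE_I2) auto
    show "AE \<theta> in lebesgue_on J. norm (k (sq n, \<theta>) * \<phi> \<theta>) \<le> M * norm (\<phi> \<theta>)" for n
      using M sq by (intro AE_I2) (auto simp: abs_mult intro!: mult_right_mono)
  qed (use km s sq in auto)
  then show "((\<lambda>s. LINT \<theta>|lebesgue_on J. k (s, \<theta>) * \<phi> \<theta>) \<circ> sq) \<longlonglongrightarrow> (LINT \<theta>|lebesgue_on J. k (s, \<theta>) * \<phi> \<theta>)"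
    by (simp add: o_def)
qed

text \<open>The interior of a product is the product of the interiors, which preserves the support
  condition. The second identity makes the derivative in direction \<open>(1, 0)\<close> act on the
  first factor alone.\<close>

lemma test_function_Times:
  fixes \<eta> \<psi> :: "real \<Rightarrow> real"
  assumes \<eta>: "test_function I \<eta>" and \<psi>: "test_function J \<psi>"
  defines "h \<equiv> (\<lambda>z. \<eta> (fst z) * \<psi> (snd z))"
  shows "test_function (I \<times> J) h"
    and "frechet_derivative h (at z) (1, 0) = frechet_derivative \<eta> (at (fst z)) 1 * \<psi> (snd z)"
proof -
  let ?d = "\<lambda>x. frechet_derivative \<eta> (at x) 1" and ?e = "\<lambda>x. frechet_derivative \<psi> (at x) 1"
  have D: "(h has_derivative (\<lambda>v. \<eta> (fst z) * (?e (snd z) * snd v) + ?d (fst z) * fst v * \<psi> (snd z))) (at z)" for z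
  proof -
    have 1: "((\<lambda>z. \<eta> (fst z)) has_derivative (\<lambda>v. ?d (fst z) * fst v)) (at z)"
      using has_derivative_compose[OF has_derivative_fst[OF has_derivative_ident]
          test_function_has_derivative[OF \<eta>, of "fst z", unfolded has_field_derivative_def], of UNIV]
      by simp
    have 2: "((\<lambda>z. \<psi> (snd z)) has_derivative (\<lambda>v. ?e (snd z) * snd v)) (at z)"
      using has_derivative_compose[OF has_derivative_snd[OF has_derivative_ident]
          test_function_has_derivative[OF \<psi>, of "snd z", unfolded has_field_derivative_def], of UNIV]
      by simp
    show ?thesis
      unfolding h_def by (rule has_derivative_mult[OF 1 2])
  qed
  have fd: "frechet_derivative h (at z) = (\<lambda>v. \<eta> (fst z) * (?e (snd z) * snd v) + ?d (fst z) * fst v * \<psi> (snd z))" for z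
    using frechet_derivative_at[OF D] by simp
  then show "frechet_derivative h (at z) (1, 0) = ?d (fst z) * \<psi> (snd z)" by simp
  have c: "continuous_on UNIV (\<lambda>z::real\<times>real. f (fst z))" "continuous_on UNIV (\<lambda>z::real\<times>real. f (snd z))"
    if "continuous_on UNIV f" for f :: "real \<Rightarrow> real"
    using that by (auto intro!: continuous_on_compose2[OF that] continuous_intros)
  have cc: "continuous_on UNIV \<eta>" "continuous_on UNIV \<psi>" "continuous_on UNIV ?d" "continuous_on UNIV ?e"
    using test_function_continuous[OF \<eta>] test_function_continuous[OF \<psi>] by auto
  obtain A B where A: "compact A" "A \<subseteq> interior I" "\<And>x. x \<notin> A \<Longrightarrow> \<eta> x = 0"
    and B: "compact B" "B \<subseteq> interior J" "\<And>x. x \<notin> B \<Longrightarrow> \<psi> x = 0"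
    using \<eta> \<psi> unfolding test_function_def by metis
  show "test_function (I \<times> J) h"
    unfolding test_function_def
  proof (intro conjI ballI)
    show "h differentiable_on UNIV"
      using D by (auto simp: differentiable_on_def differentiable_def)
    show "continuous_on UNIV (\<lambda>x. frechet_derivative h (at x) b)" for b
      unfolding fd by (intro continuous_intros c cc)
    show "\<exists>C. compact C \<and> C \<subseteq> interior (I \<times> J) \<and> (\<forall>x. x \<notin> C \<longrightarrow> h x = 0)"
      using A B by (intro exI[of _ "A \<times> B"]) (auto simp: compact_Times interior_Times h_def)
  qed
qed

section \<open>Measurability and Fubini in the plane\<close>

lemma borel_measurable_lebesgue_onI:
  fixes f :: "'a::euclidean_space \<Rightarrow> real"
  assumes "f \<in> borel_measurable borel" shows "f \<in> borel_measurable (lebesgue_on D)"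
  using assms by (intro measurable_restrict_space1 measurable_completion) simp

lemma borel_measurable_fst_snd:
  fixes p :: "real \<Rightarrow> real"
  assumes "p \<in> borel_measurable borel"
  shows "(\<lambda>z::real \<times> real. p (fst z)) \<in> borel_measurable borel"
    and "(\<lambda>z::real \<times> real. p (snd z)) \<in> borel_measurable borel"
  using measurable_compose[OF borel_measurable_continuous_onI[OF continuous_on_fst[OF continuous_on_id]] assms]
    measurable_compose[OF borel_measurable_continuous_onI[OF continuous_on_snd[OF continuous_on_id]] assms]
  by blast+

text \<open>The bound is asked for only where \<open>g\<close> is nonzero, so that a bound on a
  compact rectangle suffices once \<open>g\<close> has been extended by zero.\<close>

lemma integrable_lborel_mult_bounded:
  fixes f g :: "'a::euclidean_space \<Rightarrow> real"
  assumes g: "integrable lborel g" and f: "f \<in> borel_measurable borel"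
    and bound: "\<And>x. g x \<noteq> 0 \<Longrightarrow> \<bar>f x\<bar> \<le> M"
  shows "integrable lborel (\<lambda>x. f x * g x)"
proof (rule Bochner_Integration.integrable_bound)
  show "integrable lborel (\<lambda>x. M * g x)" using g by simp
  have "\<bar>f x * g x\<bar> \<le> \<bar>M * g x\<bar>" for x
    using bound[of x] by (cases "g x = 0") (auto simp: abs_mult intro!: mult_right_mono)
  then show "AE x in lborel. norm (f x * g x) \<le> norm (M * g x)" by simp
  show "(\<lambda>x. f x * g x) \<in> borel_measurable lborel"
    using f borel_measurable_integrable[OF g] by simp
qed

text \<open>Fubini for \<open>lborel\<close> on the product type itself, the measure to which
  integrals over a rectangle with respect to \<open>lebesgue_on\<close> reduce.\<close>

lemma
  fixes F :: "'a::euclidean_space \<times> 'b::euclidean_space \<Rightarrow> real"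
  assumes F: "integrable lborel F"
  shows lborel_AE_integrable_fst: "AE x in lborel. integrable lborel (\<lambda>y. F (x, y))"
    and lborel_integrable_fst: "integrable lborel (\<lambda>x. LBINT y. F (x, y))"
    and lborel_integral_fst: "(LBINT x. LBINT y. F (x, y)) = integral\<^sup>L lborel F"
    and lborel_integrable_snd: "integrable lborel (\<lambda>y. LBINT x. F (x, y))"
    and lborel_integral_snd: "(LBINT y. LBINT x. F (x, y)) = integral\<^sup>L lborel F"
proof -
  have "integrable (lborel \<Otimes>\<^sub>M lborel) (\<lambda>(x, y). F (x, y))"
    unfolding case_prod_eta lborel_prod by (rule F)
  note * = lborel_pair.AE_integrable_fst[OF this] lborel_pair.integrable_fst[OF this]
    lborel_pair.integral_fst[OF this] lborel_pair.integrable_snd[OF this] lborel_pair.integral_snd[OF this]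
  show "AE x in lborel. integrable lborel (\<lambda>y. F (x, y))"
    "integrable lborel (\<lambda>x. LBINT y. F (x, y))" "(LBINT x. LBINT y. F (x, y)) = integral\<^sup>L lborel F"
    "integrable lborel (\<lambda>y. LBINT x. F (x, y))" "(LBINT y. LBINT x. F (x, y)) = integral\<^sup>L lborel F"
    using *[unfolded case_prod_eta lborel_prod] by blast+
qed

text \<open>For a fixed test function \<open>\<eta>\<close>, the function \<open>\<theta> \<mapsto> \<integral> \<eta>' k + \<eta> g ds\<close> is a weak derivative
  of \<open>0\<close>, hence integrates to zero against \<open>\<phi>\<close> by the product rule for primitives. This avoids
  an approximation of \<open>\<phi>\<close> by test functions.\<close>

lemma W2_integral_operator:
  fixes k :: "real \<times> real \<Rightarrow> real" and \<phi> :: "real \<Rightarrow> real"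
  assumes "a < b" "c < d" and k: "k \<in> W2 ({a..b} \<times> {c..d})" and \<phi>: "\<phi> \<in> W2 {c..d}"
  shows "(\<lambda>s. LINT \<theta>|lebesgue_on {c..d}. k (s, \<theta>) * \<phi> \<theta>) \<in> W2 {a..b}"
proof -
  let ?D = "{a..b} \<times> {c..d}"
  have cD: "compact ?D" by (simp add: compact_Times)
  have bD: "?D \<in> sets borel" using cD by (rule borel_compact)
  define f where "f s = (LINT \<theta>|lebesgue_on {c..d}. k (s, \<theta>) * \<phi> \<theta>)" for s
  have cf: "continuous_on {a..b} f"
    unfolding f_def
    by (rule continuous_on_integral_operator[OF compact_Icc compact_Icc W2_D(1)[OF k]
          L2_imp_integrable[OF compact_Icc W2_D(2)[OF \<phi>]]])
  have "(1, 0) \<in> (Basis :: (real \<times> real) set)" by (simp add: Basis_prod_def)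
  from W2_D(3)[OF k this] obtain g0 where g0: "g0 \<in> L2 ?D" "weak_partial ?D (1, 0) k g0" by blast
  obtain g where [measurable]: "g \<in> borel_measurable borel" and gout: "\<And>z. z \<notin> ?D \<Longrightarrow> g z = 0"
    and gae: "AE z in lebesgue_on ?D. g0 z = g z"
    using borel_representative[OF L2_D(1)[OF g0(1)] bD] by auto
  have ind: "(\<lambda>z. indicator ?D z * g z) = g" "(\<lambda>z. indicator ?D z * (g z)\<^sup>2) = (\<lambda>z. (g z)\<^sup>2)"
    by (rule ext, case_tac "z \<in> ?D"; simp add: gout)+
  have gm: "g \<in> borel_measurable (lebesgue_on ?D)"
    by (rule borel_measurable_lebesgue_onI) simp
  have "integrable (lebesgue_on ?D) (\<lambda>z. (g z)\<^sup>2)"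
    using L2_D[OF g0(1)] gm gae
    by (subst integrable_cong_AE[of _ _ "\<lambda>z. (norm (g0 z))\<^sup>2"]) auto
  then have gL2: "g \<in> L2 ?D" and g2: "integrable lborel (\<lambda>z. (g z)\<^sup>2)"
    using gm bD by (auto simp: L2_def integrable_lebesgue_on_iff_lborel ind)
  have g1: "integrable lborel g"
    using L2_imp_integrable[OF cD gL2] bD by (simp add: integrable_lebesgue_on_iff_lborel ind)
  have wg: "weak_partial ?D (1, 0) k g"
    using cD gm gae L2_D(1)[OF g0(1)]
    by (intro weak_partial_cong_AE[OF g0(2)]) (auto simp: compact_sets_lebesgue)
  \<comment> \<open>\<open>k0\<close> and \<open>\<phi>0\<close> are extensions by zero. They are
    Borel, and integrals over the rectangle become integrals over the plane.\<close>
  define k0 where "k0 z = indicator ?D z * k z" for z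
  have k0[measurable]: "k0 \<in> borel_measurable borel"
    using borel_measurable_continuous_on_indicator[OF bD W2_D(1)[OF k]] by (simp add: k0_def[abs_def])
  have k0i: "integrable lborel k0"
    using borel_integrable_compact[OF cD W2_D(1)[OF k]] by (simp add: k0_def[abs_def])
  define \<phi>0 where "\<phi>0 \<theta> = indicator {c..d} \<theta> * \<phi> \<theta>" for \<theta>
  have \<phi>0[measurable]: "\<phi>0 \<in> borel_measurable borel"
    using borel_measurable_continuous_on_indicator[OF _ W2_D(1)[OF \<phi>]] by (simp add: \<phi>0_def[abs_def])
  obtain N where N: "0 \<le> N" "\<And>x. x \<in> {c..d} \<Longrightarrow> norm (\<phi> x) \<le> N"
    using continuous_on_compact_bound[OF compact_Icc W2_D(1)[OF \<phi>]] by metis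
  have \<phi>0N: "\<bar>\<phi>0 x\<bar> \<le> N" for x
    using N by (auto simp: \<phi>0_def indicator_def)
  \<comment> \<open>The candidate for the derivative of \<open>f\<close>: what formal
    differentiation under the integral sign produces.\<close>
  define G where "G s = (LBINT \<theta>. \<phi>0 \<theta> * g (s, \<theta>))" for s
  have G[measurable]: "G \<in> borel_measurable borel"
    unfolding G_def by measurable
  have Gout: "G s = 0" if "s \<notin> {a..b}" for s
  proof -
    have "g (s, \<theta>) = 0" for \<theta>
      using that by (intro gout) auto
    then show ?thesis by (simp add: G_def)
  qed
  have G2: "integrable lborel (\<lambda>s. (G s)\<^sup>2)"
  proof (rule Bochner_Integration.integrable_bound)
    \<comment> \<open>In the majorant, \<open>N\<^sup>2\<close> bounds the square of
      \<open>\<phi>0\<close> and \<open>d - c\<close> is the length coming from Cauchy-Schwarz.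
      Sections of \<open>g\<close> and of its square are integrable for almost every
      \<open>s\<close> only, hence an estimate almost everywhere.\<close>
    show "integrable lborel (\<lambda>s. N\<^sup>2 * (d - c) * (LBINT \<theta>. (g (s, \<theta>))\<^sup>2))"
      using lborel_integrable_fst[OF g2] by simp
    show "AE s in lborel. norm ((G s)\<^sup>2) \<le> norm (N\<^sup>2 * (d - c) * (LBINT \<theta>. (g (s, \<theta>))\<^sup>2))"
      using lborel_AE_integrable_fst[OF g2] lborel_AE_integrable_fst[OF g1]
    proof eventually_elim
      case (elim s)
      interpret finite_measure "lebesgue_on {c..d}"
        by (rule finite_measure_lebesgue_on_compact[OF compact_Icc])
      define u where "u \<theta> = \<phi>0 \<theta> * g (s, \<theta>)" for \<theta>
      have [measurable]: "u \<in> borel_measurable borel" unfolding u_def by measurable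
      have ui: "integrable lborel u"
        unfolding u_def using \<phi>0N by (intro integrable_lborel_mult_bounded[OF elim(2)]) auto
      have "integrable lborel (\<lambda>\<theta>. (\<phi>0 \<theta>)\<^sup>2 * (g (s, \<theta>))\<^sup>2)"
        using power_mono[OF \<phi>0N abs_ge_zero, where n=2]
        by (intro integrable_lborel_mult_bounded[OF elim(1), of _ "N\<^sup>2"]) auto
      then have u2i: "integrable lborel (\<lambda>\<theta>. (u \<theta>)\<^sup>2)"
        by (simp add: u_def power_mult_distrib)
      have indu: "(\<lambda>\<theta>. indicator {c..d} \<theta> * u \<theta>) = u" "(\<lambda>\<theta>. indicator {c..d} \<theta> * (u \<theta>)\<^sup>2) = (\<lambda>\<theta>. (u \<theta>)\<^sup>2)"
        by (auto simp: fun_eq_iff u_def \<phi>0_def indicator_def)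
      have "(LINT \<theta>|lebesgue_on {c..d}. u \<theta>)\<^sup>2 \<le> measure (lebesgue_on {c..d}) {c..d} * (LINT \<theta>|lebesgue_on {c..d}. (u \<theta>)\<^sup>2)"
        using square_integral_le[of u] ui u2i by (simp add: integrable_lebesgue_on_iff_lborel indu)
      also have "measure (lebesgue_on {c..d}) {c..d} = d - c"
        using \<open>c < d\<close> by (simp add: measure_restrict_space)
      finally have "(G s)\<^sup>2 \<le> (d - c) * (LBINT \<theta>. (u \<theta>)\<^sup>2)"
        by (simp add: integral_lebesgue_on_eq_lborel indu G_def u_def[symmetric])
      also have "(LBINT \<theta>. (u \<theta>)\<^sup>2) \<le> (LBINT \<theta>. N\<^sup>2 * (g (s, \<theta>))\<^sup>2)"
        using power_mono[OF \<phi>0N abs_ge_zero, where n=2] elim(1) u2i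
        by (intro integral_mono) (auto simp: u_def power_mult_distrib mult_right_mono)
      finally show ?case
        using \<open>c < d\<close> elim(1) by (auto simp: mult_ac mult_left_mono)
    qed
  qed measurable
  have "integrable (lebesgue_on {a..b}) (\<lambda>s. (G s)\<^sup>2)"
  proof -
    have "(\<lambda>s. indicator {a..b} s * (G s)\<^sup>2) = (\<lambda>s. (G s)\<^sup>2)"
      using Gout by (auto simp: fun_eq_iff indicator_def)
    with G2 show ?thesis by (simp add: integrable_lebesgue_on_iff_lborel)
  qed
  then have GL2: "G \<in> L2 {a..b}"
    by (simp add: L2_def borel_measurable_lebesgue_onI)
  obtain \<phi>' where \<phi>': "primitive_on c d \<phi> \<phi>'"
    using \<phi> unfolding W2_real_interval_iff[OF \<open>c < d\<close>] by blast
  have "weak_partial {a..b} 1 f G"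
    unfolding weak_partial_def
  proof (intro allI impI)
    fix \<eta> :: "real \<Rightarrow> real" assume \<eta>: "test_function {a..b} \<eta>"
    define d' where "d' x = frechet_derivative \<eta> (at x) 1" for x
    have c\<eta>: "continuous_on A \<eta>" "continuous_on A d'" for A
      using test_function_continuous[OF \<eta>] by (auto simp: d'_def[abs_def])
    have bm: "\<eta> \<in> borel_measurable borel" "d' \<in> borel_measurable borel"
      using c\<eta> by (auto intro: borel_measurable_continuous_onI)
    note [measurable] = bm bm[THEN borel_measurable_fst_snd(1)] borel_measurable_fst_snd(2)[OF \<phi>0]
    obtain B where B: "0 \<le> B" "\<And>x. x \<in> {a..b} \<Longrightarrow> norm (\<eta> x) \<le> B"
      using continuous_on_compact_bound[OF compact_Icc c\<eta>(1)] by metis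
    obtain B' where B': "0 \<le> B'" "\<And>x. x \<in> {a..b} \<Longrightarrow> norm (d' x) \<le> B'"
      using continuous_on_compact_bound[OF compact_Icc c\<eta>(2)] by metis
    have dk: "integrable lborel (\<lambda>z. d' (fst z) * k0 z)"
      by (rule integrable_lborel_mult_bounded[OF k0i, of _ B']) (use B' in \<open>measurable, auto simp: k0_def indicator_def split: if_splits\<close>)
    have \<eta>g: "integrable lborel (\<lambda>z. \<eta> (fst z) * g z)"
    proof (rule integrable_lborel_mult_bounded[OF g1, of _ B])
      show "\<bar>\<eta> (fst z)\<bar> \<le> B" if "g z \<noteq> 0" for z
        using gout[of z] that B by (cases z) force
    qed measurable
    \<comment> \<open>\<open>E\<close> is formally the s-derivative of \<eta> k. The claim is
      equivalent to the vanishing of the integral of \<open>E\<close> against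
      \<open>\<phi>0\<close>, and \<open>h\<close> is the marginal of \<open>E\<close> in
      \<theta>.\<close>
    define E where "E z = d' (fst z) * k0 z + \<eta> (fst z) * g z" for z
    have Ei: "integrable lborel E"
      unfolding E_def using dk \<eta>g by simp
    have [measurable]: "E \<in> borel_measurable borel" unfolding E_def by measurable
    have Eout: "E z = 0" if "z \<notin> ?D" for z
      using that gout[of z] by (simp add: E_def k0_def)
    define h where "h \<theta> = (LBINT s. E (s, \<theta>))" for \<theta>
    have hi: "integrable lborel h"
      using lborel_integrable_snd[OF Ei] by (simp add: h_def[abs_def])
    have [measurable]: "h \<in> borel_measurable borel" using hi by (auto dest: borel_measurable_integrable)
    have hout: "h \<theta> = 0" if "\<theta> \<notin> {c..d}" for \<theta>
    proof -
      have "E (s, \<theta>) = 0" for s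
        using that by (intro Eout) auto
      then show ?thesis by (simp add: h_def)
    qed
    \<comment> \<open>Used twice: with a test function for \<open>p\<close>, where the weak identity
      for \<open>k\<close> applies, and with \<open>\<phi>0\<close>, which is the target.\<close>
    have wE: "(LBINT \<theta>. p \<theta> * h \<theta>) = integral\<^sup>L lborel (\<lambda>z. p (snd z) * E z)"
      if pm: "p \<in> borel_measurable borel" and p: "\<And>x. x \<in> {c..d} \<Longrightarrow> \<bar>p x\<bar> \<le> C" for p C
    proof -
      have "integrable lborel (\<lambda>z. p (snd z) * E z)"
      proof (rule integrable_lborel_mult_bounded[OF Ei, of _ C])
        show "\<bar>p (snd z)\<bar> \<le> C" if "E z \<noteq> 0" for z
          using Eout[of z] that p by (cases z) force
      qed (rule borel_measurable_fst_snd(2)[OF pm])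
      from lborel_integral_snd[OF this] show ?thesis
        by (simp add: h_def)
    qed
    have "weak_partial {c..d} 1 (\<lambda>_. 0) h"
      unfolding weak_partial_def
    proof (intro allI impI)
      fix \<psi> :: "real \<Rightarrow> real" assume \<psi>: "test_function {c..d} \<psi>"
      have \<psi>m: "\<psi> \<in> borel_measurable borel"
        using test_function_continuous(1)[OF \<psi>] by (auto intro: borel_measurable_continuous_onI)
      note [measurable] = \<psi>m borel_measurable_fst_snd(2)[OF \<psi>m]
      obtain C where C: "\<And>x. x \<in> {c..d} \<Longrightarrow> \<bar>\<psi> x\<bar> \<le> C"
        using continuous_on_compact_bound[OF compact_Icc test_function_continuous(1)[OF \<psi>]]
        by (metis real_norm_def)
      let ?h = "\<lambda>z. \<eta> (fst z) * \<psi> (snd z)"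
      note T = test_function_Times[OF \<eta> \<psi>, folded d'_def]
      have eq: "(LINT z|lebesgue_on ?D. d' (fst z) * \<psi> (snd z) * k z) = - (LINT z|lebesgue_on ?D. ?h z * g z)"
        using wg[unfolded weak_partial_def, rule_format, OF T(1)] by (simp add: T(2))
      have i1: "integrable (lebesgue_on ?D) (\<lambda>z. d' (fst z) * \<psi> (snd z) * k z)"
        using integrable_continuous_scaleR_L2[OF cD test_function_continuous(2)[OF T(1), of "(1,0)"] W2_D(2)[OF k]]
        by (simp add: T(2) Basis_prod_def)
      have i2: "integrable (lebesgue_on ?D) (\<lambda>z. ?h z * g z)"
        using integrable_continuous_scaleR_L2[OF cD test_function_continuous(1)[OF T(1)] gL2] by simp
      have \<psi>E: "(\<lambda>z. \<psi> (snd z) * E z) = (\<lambda>z. indicator ?D z * (d' (fst z) * \<psi> (snd z) * k z + ?h z * g z))"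
      proof
        fix z
        show "\<psi> (snd z) * E z = indicator ?D z * (d' (fst z) * \<psi> (snd z) * k z + ?h z * g z)"
          by (cases "z \<in> ?D") (simp_all add: gout E_def k0_def algebra_simps)
      qed
      have "(LBINT \<theta>. \<psi> \<theta> * h \<theta>) = integral\<^sup>L lborel (\<lambda>z. \<psi> (snd z) * E z)"
        by (rule wE[OF _ C]) auto
      also note \<psi>E
      also have "integral\<^sup>L lborel (\<lambda>z. indicator ?D z * (d' (fst z) * \<psi> (snd z) * k z + ?h z * g z)) = (LINT z|lebesgue_on ?D. d' (fst z) * \<psi> (snd z) * k z + ?h z * g z)"
      proof (rule integral_lebesgue_on_eq_lborel[OF bD, symmetric])
        have "(\<lambda>z. \<psi> (snd z) * E z) \<in> borel_measurable borel" by measurable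
        also note \<psi>E
        finally show "(\<lambda>z. indicator ?D z * (d' (fst z) * \<psi> (snd z) * k z + ?h z * g z)) \<in> borel_measurable borel" .
      qed
      also have "\<dots> = 0"
        using eq by (subst Bochner_Integration.integral_add[OF i1 i2]) simp
      finally have 0: "(LBINT \<theta>. \<psi> \<theta> * h \<theta>) = 0" .
      have "(\<lambda>\<theta>. indicator {c..d} \<theta> * (\<psi> \<theta> * h \<theta>)) = (\<lambda>\<theta>. \<psi> \<theta> * h \<theta>)"
        using hout by (auto simp: fun_eq_iff indicator_def)
      with 0 have "(LINT \<theta>|lebesgue_on {c..d}. \<psi> \<theta> * h \<theta>) = 0"
        by (subst integral_lebesgue_on_eq_lborel) auto
      then show "(LINT x|lebesgue_on {c..d}. frechet_derivative \<psi> (at x) 1 *\<^sub>R 0) =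
          - (LINT x|lebesgue_on {c..d}. \<psi> x *\<^sub>R h x)" by simp
    qed
    then have "primitive_on c d (\<lambda>_. 0) h"
      by (intro weak_partial_imp_primitive_on[OF \<open>c < d\<close> _ _ hi hout]) auto
    \<comment> \<open>The zero function, with density \<open>h\<close>, is multiplied by
      \<open>\<phi>\<close>. The product is zero at both ends, and its density is
      \<open>h t * \<phi> t\<close> because the term with \<open>\<phi>'\<close> carries the factor
      0.\<close>
    from primitive_on_mult[OF this \<phi>']
    have "(LBINT t:{..d}. h t * \<phi> t) = 0"
      using \<open>c < d\<close> by (simp add: primitive_on_def)
    also have "(LBINT t:{..d}. h t * \<phi> t) = (LBINT t. \<phi>0 t * h t)"
      unfolding set_lebesgue_integral_def using hout
      by (intro Bochner_Integration.integral_cong) (auto simp: indicator_def \<phi>0_def)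
    also have "\<dots> = integral\<^sup>L lborel (\<lambda>z. \<phi>0 (snd z) * E z)"
      by (rule wE[OF _ \<phi>0N]) simp
    also have "\<dots> = integral\<^sup>L lborel (\<lambda>z. \<phi>0 (snd z) * (d' (fst z) * k0 z) + \<phi>0 (snd z) * (\<eta> (fst z) * g z))"
      by (simp add: E_def algebra_simps)
    also have "\<dots> = integral\<^sup>L lborel (\<lambda>z. \<phi>0 (snd z) * (d' (fst z) * k0 z)) + integral\<^sup>L lborel (\<lambda>z. \<phi>0 (snd z) * (\<eta> (fst z) * g z))"
      using \<phi>0N by (intro Bochner_Integration.integral_add integrable_lborel_mult_bounded[OF dk] integrable_lborel_mult_bounded[OF \<eta>g]) auto
    \<comment> \<open>Integrating in \<theta> first, the two parts of \<open>E\<close> give back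
      \<open>f\<close> tested with \<open>d'\<close> and \<open>G\<close> tested with
      \<open>\<eta>\<close>; the vanishing of their sum is the weak identity.\<close>
    also have "integral\<^sup>L lborel (\<lambda>z. \<phi>0 (snd z) * (d' (fst z) * k0 z)) = (LINT s|lebesgue_on {a..b}. d' s * f s)"
    proof -
      have i: "integrable lborel (\<lambda>z. \<phi>0 (snd z) * (d' (fst z) * k0 z))"
        using \<phi>0N by (intro integrable_lborel_mult_bounded[OF dk]) auto
      have sec: "(LBINT \<theta>. \<phi>0 \<theta> * (d' s * k0 (s, \<theta>))) = indicator {a..b} s * (d' s * f s)" for s
      proof (cases "s \<in> {a..b}")
        case True
        have e: "(\<lambda>\<theta>. indicator {c..d} \<theta> * (k (s, \<theta>) * \<phi> \<theta>)) = (\<lambda>\<theta>. \<phi>0 \<theta> * k0 (s, \<theta>))"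
          using True by (auto simp: fun_eq_iff \<phi>0_def k0_def indicator_def)
        have "f s = (LBINT \<theta>. \<phi>0 \<theta> * k0 (s, \<theta>))"
          unfolding f_def by (subst integral_lebesgue_on_eq_lborel) (auto simp: e)
        moreover have "(\<lambda>\<theta>. \<phi>0 \<theta> * (d' s * k0 (s, \<theta>))) = (\<lambda>\<theta>. d' s * (\<phi>0 \<theta> * k0 (s, \<theta>)))"
          by (simp add: fun_eq_iff)
        ultimately show ?thesis using True by simp
      next
        case False
        then have "k0 (s, \<theta>) = 0" for \<theta> by (auto simp: k0_def indicator_def)
        then show ?thesis using False by simp
      qed
      have "integral\<^sup>L lborel (\<lambda>z. \<phi>0 (snd z) * (d' (fst z) * k0 z)) = (LBINT s. indicator {a..b} s * (d' s * f s))"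
        using lborel_integral_fst[OF i] by (simp add: sec)
      also have "\<dots> = (LINT s|lebesgue_on {a..b}. d' s * f s)"
        using borel_measurable_continuous_on_indicator[OF _ continuous_on_mult[OF c\<eta>(2) cf]]
        by (intro integral_lebesgue_on_eq_lborel[symmetric]) auto
      finally show ?thesis .
    qed
    also have "integral\<^sup>L lborel (\<lambda>z. \<phi>0 (snd z) * (\<eta> (fst z) * g z)) = (LINT s|lebesgue_on {a..b}. \<eta> s * G s)"
    proof -
      have i: "integrable lborel (\<lambda>z. \<phi>0 (snd z) * (\<eta> (fst z) * g z))"
        using \<phi>0N by (intro integrable_lborel_mult_bounded[OF \<eta>g]) auto
      have sec: "(LBINT \<theta>. \<phi>0 \<theta> * (\<eta> s * g (s, \<theta>))) = indicator {a..b} s * (\<eta> s * G s)" for s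
      proof -
        have "(\<lambda>\<theta>. \<phi>0 \<theta> * (\<eta> s * g (s, \<theta>))) = (\<lambda>\<theta>. \<eta> s * (\<phi>0 \<theta> * g (s, \<theta>)))"
          by (simp add: fun_eq_iff)
        then show ?thesis using Gout[of s] by (auto simp: G_def indicator_def)
      qed
      have "integral\<^sup>L lborel (\<lambda>z. \<phi>0 (snd z) * (\<eta> (fst z) * g z)) = (LBINT s. indicator {a..b} s * (\<eta> s * G s))"
        using lborel_integral_fst[OF i] by (simp add: sec)
      also have "\<dots> = (LINT s|lebesgue_on {a..b}. \<eta> s * G s)"
        by (intro integral_lebesgue_on_eq_lborel[symmetric]) auto
      finally show ?thesis .
    qed
    finally show "(LINT x|lebesgue_on {a..b}. frechet_derivative \<eta> (at x) 1 *\<^sub>R f x) =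
        - (LINT x|lebesgue_on {a..b}. \<eta> x *\<^sub>R G x)"
      by (simp add: d'_def[symmetric])
  qed
  with GL2 cf have "f \<in> W2 {a..b}"
    unfolding W2_def by (auto intro: L2_continuous)
  then show ?thesis by (simp add: f_def[abs_def])
qed

section \<open>Matrix-valued coefficients\<close>

lemma L2_vec_iff:
  fixes f :: "'a::euclidean_space \<Rightarrow> real ^ 'n"
  shows "f \<in> L2 D \<longleftrightarrow> (\<forall>r. (\<lambda>x. f x $ r) \<in> L2 D)"
  unfolding L2_componentwise_iff[of f] by (auto simp: Basis_vec_def inner_axis)

lemma L2_vec_nth:
  fixes f :: "'a::euclidean_space \<Rightarrow> real ^ 'n"
  shows "f \<in> L2 D \<Longrightarrow> (\<lambda>x. f x $ r) \<in> L2 D"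
  using L2_vec_iff by blast

lemma W2_vec_nth:
  fixes f :: "'a::euclidean_space \<Rightarrow> 'b::euclidean_space ^ 'n"
  assumes "compact D" "f \<in> W2 D"
  shows "(\<lambda>x. f x $ r) \<in> W2 D"
  by (rule W2_bounded_linear[OF assms bounded_linear_vec_nth])

lemma W2_vecI:
  fixes f :: "'a::euclidean_space \<Rightarrow> real ^ 'n"
  assumes "compact D" "\<And>r. (\<lambda>x. f x $ r) \<in> W2 D"
  shows "f \<in> W2 D"
proof (rule W2_componentwise[OF assms(1)])
  fix i :: "real ^ 'n" assume "i \<in> Basis"
  then obtain r where "i = axis r 1" by (auto simp: Basis_vec_def)
  with assms(2)[of r] show "(\<lambda>x. f x \<bullet> i) \<in> W2 D" by (simp add: inner_axis)
qed

lemma matrix_vector_mult_nth: "(A *v x) $ r = (\<Sum>c\<in>UNIV. A $ r $ c * x $ c)"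
  by (simp add: matrix_vector_mult_def)

lemma bounded_bilinear_matrix_vector_mult:
  "bounded_bilinear ((*v) :: real ^ 'n ^ 'm \<Rightarrow> real ^ 'n \<Rightarrow> real ^ 'm)"
proof -
  have "bilinear ((*v) :: real ^ 'n ^ 'm \<Rightarrow> real ^ 'n \<Rightarrow> real ^ 'm)"
    unfolding bilinear_def
    by (intro conjI allI linearI)
       (simp_all only: matrix_vector_mult_add_rdistrib matrix_vector_right_distrib
        scaleR_matrix_vector_assoc[symmetric] matrix_vector_mult_scaleR)
  then show ?thesis by (simp add: bilinear_conv_bounded_bilinear)
qed

lemmas continuous_on_matrix_vector_mult =
  bounded_bilinear.continuous_on[OF bounded_bilinear_matrix_vector_mult]

text \<open>With the vector fixed the expression is linear in the matrix, so the term with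
  \<open>transpose (Q i s)\<close> inherits its regularity from \<open>Q i\<close> without a product
  rule.\<close>

lemma bounded_linear_transpose_mult: "bounded_linear (\<lambda>A :: real ^ 'n ^ 'm. transpose A *v x)"
proof -
  have "linear (\<lambda>A :: real ^ 'n ^ 'm. transpose A *v x)"
    by (intro linearI)
       (simp_all add: vec_eq_iff matrix_vector_mult_nth transpose_def sum.distrib sum_distrib_left algebra_simps)
  then show ?thesis by (simp add: linear_conv_bounded_linear)
qed

lemma matrix_bound_on_compact:
  fixes A :: "'a::topological_space \<Rightarrow> real ^ 'n ^ 'm"
  assumes "compact D" "continuous_on D A"
  shows "\<exists>B\<ge>0. \<forall>s\<in>D. \<forall>v. norm (A s *v v) \<le> B * norm v"
proof -
  obtain M where M: "0 \<le> M" "\<And>s. s \<in> D \<Longrightarrow> norm (A s) \<le> M"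
    using continuous_on_compact_bound[OF assms] by metis
  obtain C where C: "0 \<le> C" "\<And>(X :: real ^ 'n ^ 'm) v. norm (X *v v) \<le> norm X * norm v * C"
    using bounded_bilinear.nonneg_bounded[OF bounded_bilinear_matrix_vector_mult] by metis
  show ?thesis
  proof (intro exI[of _ "M * C"] conjI ballI allI)
    show "0 \<le> M * C" using M C by simp
    fix s v assume s: "s \<in> D"
    have "norm (A s *v v) \<le> norm (A s) * norm v * C" by (rule C(2))
    also have "\<dots> \<le> M * norm v * C"
      using M(2)[OF s] C(1) by (intro mult_right_mono) auto
    finally show "norm (A s *v v) \<le> M * C * norm v" by (simp add: mult_ac)
  qed
qed

lemma L2_matrix_vector_mult:
  fixes A :: "'a::euclidean_space \<Rightarrow> real ^ 'n ^ 'm" and \<phi> :: "'a \<Rightarrow> real ^ 'n"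
  assumes D: "compact D" and A: "continuous_on D A" and \<phi>: "\<phi> \<in> L2 D"
  shows "(\<lambda>x. A x *v \<phi> x) \<in> L2 D"
  unfolding L2_vec_iff matrix_vector_mult_nth
  by (intro allI L2_sum L2_mult_continuous[OF D] L2_vec_nth[OF \<phi>] continuous_on_component A)

lemma integrable_matrix_vector_mult:
  fixes A :: "'a::euclidean_space \<Rightarrow> real ^ 'n ^ 'm" and \<phi> :: "'a \<Rightarrow> real ^ 'n"
  assumes "compact D" "continuous_on D A" "\<phi> \<in> L2 D"
  shows "integrable (lebesgue_on D) (\<lambda>x. A x *v \<phi> x)"
  by (rule L2_imp_integrable[OF assms(1) L2_matrix_vector_mult[OF assms]])

lemma integral_matrix_vector_mult_nth:
  fixes A :: "'a::euclidean_space \<Rightarrow> real ^ 'n ^ 'm" and \<phi> :: "'a \<Rightarrow> real ^ 'n"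
  assumes D: "compact D" and A: "continuous_on D A" and \<phi>: "\<phi> \<in> L2 D"
  shows "(LINT x|lebesgue_on D. A x *v \<phi> x) $ r = (\<Sum>c\<in>UNIV. LINT x|lebesgue_on D. A x $ r $ c * \<phi> x $ c)"
proof -
  have "(LINT x|lebesgue_on D. A x *v \<phi> x) $ r = (LINT x|lebesgue_on D. (A x *v \<phi> x) $ r)"
    by (rule integral_bounded_linear[OF bounded_linear_vec_nth integrable_matrix_vector_mult[OF assms], symmetric])
  also have "\<dots> = (LINT x|lebesgue_on D. (\<Sum>c\<in>UNIV. A x $ r $ c * \<phi> x $ c))"
    by (simp only: matrix_vector_mult_nth)
  also have "\<dots> = (\<Sum>c\<in>UNIV. LINT x|lebesgue_on D. A x $ r $ c * \<phi> x $ c)"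
    by (intro Bochner_Integration.integral_sum L2_imp_integrable[OF D] L2_mult_continuous[OF D]
        L2_vec_nth[OF \<phi>] continuous_on_component A)
  finally show ?thesis .
qed

lemma W2_matrix_vector_mult:
  fixes A :: "real \<Rightarrow> real ^ 'n ^ 'm" and \<phi> :: "real \<Rightarrow> real ^ 'n"
  assumes "a < b" "A \<in> W2 {a..b}" "\<phi> \<in> W2 {a..b}"
  shows "(\<lambda>s. A s *v \<phi> s) \<in> W2 {a..b}"
  using assms
  by (intro W2_vecI) (simp_all add: matrix_vector_mult_nth W2_sum W2_mult W2_vec_nth)

lemma continuous_on_section:
  fixes R :: "'a::topological_space \<Rightarrow> 'b::topological_space \<Rightarrow> 'c::topological_space"
  assumes "continuous_on (I \<times> J) (\<lambda>(s, \<theta>). R s \<theta>)" "s \<in> I"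
  shows "continuous_on J (R s)"
proof -
  have "continuous_on J (\<lambda>\<theta>. (s, \<theta>))"
    by (intro continuous_on_Pair continuous_on_const continuous_on_id)
  from continuous_on_compose2[OF assms(1) this] assms(2) show ?thesis by auto
qed

text \<open>The regularity in \<open>s\<close> comes from the kernel alone. Stating it for
  \<open>\<phi>\<close> in \<open>L2\<close> makes it available on \<open>Z_space\<close>.\<close>

lemma continuous_on_matrix_integral_operator:
  fixes R :: "'a::metric_space \<Rightarrow> 'b::euclidean_space \<Rightarrow> real ^ 'n ^ 'm"
  assumes I: "compact I" and J: "compact J" and R: "continuous_on (I \<times> J) (\<lambda>(s, \<theta>). R s \<theta>)"
    and \<phi>: "\<phi> \<in> L2 J"
  shows "continuous_on I (\<lambda>s. LINT \<theta>|lebesgue_on J. R s \<theta> *v \<phi> \<theta>)"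
proof (subst continuous_on_componentwise, intro ballI)
  fix i :: "real ^ 'm" assume "i \<in> Basis"
  then obtain r where i: "i = axis r 1" by (auto simp: Basis_vec_def)
  have "continuous_on I (\<lambda>s. \<Sum>c\<in>UNIV. LINT \<theta>|lebesgue_on J. R s \<theta> $ r $ c * \<phi> \<theta> $ c)"
  proof (rule continuous_on_sum)
    fix c
    have "continuous_on (I \<times> J) (\<lambda>z. (case z of (s, \<theta>) \<Rightarrow> R s \<theta>) $ r $ c)"
      by (intro continuous_on_component R)
    from continuous_on_integral_operator[OF I J this L2_imp_integrable[OF J L2_vec_nth[OF \<phi>]]]
    show "continuous_on I (\<lambda>s. LINT \<theta>|lebesgue_on J. R s \<theta> $ r $ c * \<phi> \<theta> $ c)" by simp
  qed
  then show "continuous_on I (\<lambda>s. (LINT \<theta>|lebesgue_on J. R s \<theta> *v \<phi> \<theta>) \<bullet> i)"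
    by (rule continuous_on_eq)
       (simp add: i inner_axis integral_matrix_vector_mult_nth[OF J continuous_on_section[OF R] \<phi>])
qed

lemma W2_matrix_integral_operator:
  fixes R :: "real \<Rightarrow> real \<Rightarrow> real ^ 'n ^ 'm"
  assumes "a < b" "c < d" and R: "(\<lambda>(s, \<theta>). R s \<theta>) \<in> W2 ({a..b} \<times> {c..d})"
    and \<phi>: "\<phi> \<in> W2 {c..d}"
  shows "(\<lambda>s. LINT \<theta>|lebesgue_on {c..d}. R s \<theta> *v \<phi> \<theta>) \<in> W2 {a..b}"
proof (rule W2_vecI[OF compact_Icc])
  fix r
  have "(\<lambda>s. \<Sum>q\<in>UNIV. LINT \<theta>|lebesgue_on {c..d}. R s \<theta> $ r $ q * \<phi> \<theta> $ q) \<in> W2 {a..b}"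
  proof (rule W2_sum[OF compact_Icc])
    fix q
    have "(\<lambda>z. (case z of (s, \<theta>) \<Rightarrow> R s \<theta>) $ r $ q) \<in> W2 ({a..b} \<times> {c..d})"
      by (intro W2_vec_nth compact_Times compact_Icc R)
    from W2_integral_operator[OF \<open>a < b\<close> \<open>c < d\<close> this W2_vec_nth[OF compact_Icc \<phi>]]
    show "(\<lambda>s. LINT \<theta>|lebesgue_on {c..d}. R s \<theta> $ r $ q * \<phi> \<theta> $ q) \<in> W2 {a..b}" by simp
  qed
  \<comment> \<open>The entrywise formula relies on continuity of the section \<open>R s\<close>,
    known for \<open>s\<close> in the interval, so the two functions are compared on that interval
    only.\<close>
  then show "(\<lambda>s. (LINT \<theta>|lebesgue_on {c..d}. R s \<theta> *v \<phi> \<theta>) $ r) \<in> W2 {a..b}"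
    by (rule iffD1[OF W2_cong, rotated])
       (simp add: integral_matrix_vector_mult_nth[OF compact_Icc continuous_on_section[OF W2_D(1)[OF R]] W2_D(2)[OF \<phi>]])
qed

text \<open>The pointwise bound leaves the integral of \<open>norm (\<phi> x)\<close>.
  Cauchy-Schwarz against 1 then yields the root of the measure, which is the \<open>L2\<close> norm
  of the constant 1.\<close>

lemma norm_integral_matrix_vector_mult_le:
  fixes A :: "'a::euclidean_space \<Rightarrow> real ^ 'n ^ 'm"
  assumes D: "compact D" and A: "continuous_on D A" and \<phi>: "\<phi> \<in> L2 D"
    and B: "0 \<le> B" "\<And>s v. s \<in> D \<Longrightarrow> norm (A s *v v) \<le> B * norm v"
  shows "norm (LINT x|lebesgue_on D. A x *v \<phi> x) \<le>
    B * (sqrt (measure lebesgue D) * sqrt (LINT x|lebesgue_on D. (norm (\<phi> x))\<^sup>2))"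
proof -
  interpret finite_measure "lebesgue_on D" by (rule finite_measure_lebesgue_on_compact[OF D])
  have i: "integrable (lebesgue_on D) (\<lambda>x. norm (\<phi> x))"
    using L2_imp_integrable[OF D \<phi>] by simp
  have "norm (LINT x|lebesgue_on D. A x *v \<phi> x) \<le> (LINT x|lebesgue_on D. norm (A x *v \<phi> x))"
    by (rule integral_norm_bound)
  also have "\<dots> \<le> (LINT x|lebesgue_on D. B * norm (\<phi> x))"
    using B i integrable_matrix_vector_mult[OF D A \<phi>] by (intro integral_mono) auto
  also have "\<dots> = B * (LINT x|lebesgue_on D. norm (\<phi> x))" by simp
  also have "(LINT x|lebesgue_on D. norm (\<phi> x))\<^sup>2 \<le> measure lebesgue D * (LINT x|lebesgue_on D. (norm (\<phi> x))\<^sup>2)"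
    using square_integral_le[OF i L2_D(2)[OF \<phi>]] D
    by (simp add: measure_restrict_space compact_sets_lebesgue)
  then have "(LINT x|lebesgue_on D. norm (\<phi> x)) \<le>
      sqrt (measure lebesgue D) * sqrt (LINT x|lebesgue_on D. (norm (\<phi> x))\<^sup>2)"
    by (simp add: real_le_rsqrt flip: real_sqrt_mult)
  finally show ?thesis using B(1) by (simp add: mult_left_mono)
qed

lemma integral_lebesgue_on_swap_continuous:
  fixes F :: "real \<Rightarrow> real \<Rightarrow> real"
  assumes F: "continuous_on ({a..b} \<times> {c..d}) (\<lambda>(s, \<theta>). F s \<theta>)"
  shows "(LINT s|lebesgue_on {a..b}. LINT \<theta>|lebesgue_on {c..d}. F s \<theta>) =
    (LINT \<theta>|lebesgue_on {c..d}. LINT s|lebesgue_on {a..b}. F s \<theta>)"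
proof -
  have F': "continuous_on ({c..d} \<times> {a..b}) (\<lambda>(\<theta>, s). F s \<theta>)"
    using continuous_on_swap_args[OF F] .
  \<comment> \<open>With density 1 a plain parameter integral becomes an integral operator. Both
    outer integrands are then continuous and may be read as Henstock-Kurzweil integrals, for which
    the order can be exchanged.\<close>
  have one: "integrable (lebesgue_on {u..v}) (\<lambda>x. 1::real)" for u v :: real by simp
  have s1: "continuous_on {a..b} (\<lambda>s. LINT \<theta>|lebesgue_on {c..d}. F s \<theta>)"
    using continuous_on_integral_operator[OF compact_Icc compact_Icc F one] by simp
  have s2: "continuous_on {c..d} (\<lambda>\<theta>. LINT s|lebesgue_on {a..b}. F s \<theta>)"
    using continuous_on_integral_operator[OF compact_Icc compact_Icc F' one] by simp
  have "(LINT s|lebesgue_on {a..b}. LINT \<theta>|lebesgue_on {c..d}. F s \<theta>) = integral {a..b} (\<lambda>s. integral {c..d} (F s))"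
    unfolding integral_lebesgue_on_continuous[OF s1]
    by (intro Henstock_Kurzweil_Integration.integral_cong integral_lebesgue_on_continuous continuous_on_section[OF F])
  also have "\<dots> = integral {c..d} (\<lambda>\<theta>. integral {a..b} (\<lambda>s. F s \<theta>))"
    using integral_swap_continuous[of a c b d F] F by (simp add: cbox_Pair_eq)
  also have "\<dots> = (LINT \<theta>|lebesgue_on {c..d}. LINT s|lebesgue_on {a..b}. F s \<theta>)"
    unfolding integral_lebesgue_on_continuous[OF s2]
    by (intro Henstock_Kurzweil_Integration.integral_cong integral_lebesgue_on_continuous[symmetric] continuous_on_section[OF F'])
  finally show ?thesis .
qed

section \<open>The operator on the state space\<close>

lemma inner_transpose_matrix_vector:
  fixes A :: "real ^ 'n ^ 'm"
  shows "x \<bullet> (transpose A *v y) = (A *v x) \<bullet> y"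
proof -
  have "x \<bullet> (transpose A *v y) = (y v* A) \<bullet> x"
    by (simp only: transpose_matrix_vector inner_commute)
  also have "\<dots> = y \<bullet> (A *v x)"
    by (rule dot_lmul_matrix)
  finally show ?thesis
    by (simp only: inner_commute)
qed

lemma Z_inner_commute: "Z_inner K \<tau> z w = Z_inner K \<tau> w z"
  by (simp add: Z_inner_def inner_commute)

locale delay_operator =
  fixes K :: nat and \<tau> :: "nat \<Rightarrow> real"
    and P :: "real ^ 'n ^ 'n"
    and Q S :: "nat \<Rightarrow> real \<Rightarrow> real ^ 'n ^ 'n"
    and R :: "nat \<Rightarrow> nat \<Rightarrow> real \<Rightarrow> real \<Rightarrow> real ^ 'n ^ 'n"
  assumes K: "1 \<le> K" and tau_pos: "\<And>i. i \<in> {1..K} \<Longrightarrow> 0 < \<tau> i"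
    and Q_W2: "\<And>i. i \<in> {1..K} \<Longrightarrow> Q i \<in> W2 {-\<tau> i..0}"
    and S_W2: "\<And>i. i \<in> {1..K} \<Longrightarrow> S i \<in> W2 {-\<tau> i..0}"
    and R_W2: "\<And>i j. i \<in> {1..K} \<Longrightarrow> j \<in> {1..K} \<Longrightarrow>
           (\<lambda>(s, \<theta>). R i j s \<theta>) \<in> W2 ({-\<tau> i..0} \<times> {-\<tau> j..0})"
    and S_sym: "\<And>i s. i \<in> {1..K} \<Longrightarrow> s \<in> {-\<tau> i..0} \<Longrightarrow> S i s = transpose (S i s)"
    and R_sym: "\<And>i j s \<theta>. i \<in> {1..K} \<Longrightarrow> j \<in> {1..K} \<Longrightarrow> s \<in> {-\<tau> i..0} \<Longrightarrow> \<theta> \<in> {-\<tau> j..0} \<Longrightarrow>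
           R i j s \<theta> = transpose (R j i \<theta> s)"
    and P_eq: "\<And>i. i \<in> {1..K} \<Longrightarrow> P = \<tau> K *\<^sub>R transpose (Q i 0) + \<tau> K *\<^sub>R S i 0"
    and Q_eq: "\<And>i j s. i \<in> {1..K} \<Longrightarrow> j \<in> {1..K} \<Longrightarrow> s \<in> {-\<tau> j..0} \<Longrightarrow> Q j s = R i j 0 s"
begin

abbreviation T where "T \<equiv> P_op K \<tau> P Q S R"

lemma K_mem: "K \<in> {1..K}" and tau_K_pos: "0 < \<tau> K"
  using K tau_pos by auto

lemma zero_mem: "i \<in> {1..K} \<Longrightarrow> 0 \<in> {-\<tau> i..0}"
  using tau_pos by fastforce

lemmas Q_cont = W2_D(1)[OF Q_W2] and S_cont = W2_D(1)[OF S_W2] and R_cont = W2_D(1)[OF R_W2]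

lemma Qt_cont: "i \<in> {1..K} \<Longrightarrow> continuous_on {-\<tau> i..0} (\<lambda>s. transpose (Q i s))"
  unfolding transpose_def
  by (intro continuous_on_vec_lambda continuous_on_component Q_cont)

lemma R_section_cont:
  "i \<in> {1..K} \<Longrightarrow> j \<in> {1..K} \<Longrightarrow> s \<in> {-\<tau> i..0} \<Longrightarrow> continuous_on {-\<tau> j..0} (R i j s)"
  using continuous_on_section[OF R_cont] .

lemma Z_L2: "z \<in> Z_space K \<tau> \<Longrightarrow> i \<in> {1..K} \<Longrightarrow> snd z i \<in> L2 {-\<tau> i..0}"
  by (auto simp: Z_space_def)

lemma X_W2:
  assumes "z \<in> X_space K \<tau>" "i \<in> {1..K}"
  shows "snd z i \<in> W2 {-\<tau> i..0}" "snd z i 0 = fst z"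
  using assms by (auto simp: X_space_def)

lemma X_subset_Z: "z \<in> X_space K \<tau> \<Longrightarrow> z \<in> Z_space K \<tau>"
  by (auto simp: X_space_def)

lemma fst_T: "fst (T z) = P *v fst z + (\<Sum>i=1..K. LINT \<theta>|lebesgue_on {-\<tau> i..0}. Q i \<theta> *v snd z i \<theta>)"
  by (simp add: P_op_def case_prod_beta)

lemma snd_T:
  assumes "i \<in> {1..K}" "s \<in> {-\<tau> i..0}"
  shows "snd (T z) i s = \<tau> K *\<^sub>R (transpose (Q i s) *v fst z) + \<tau> K *\<^sub>R (S i s *v snd z i s) +
    (\<Sum>j=1..K. LINT \<theta>|lebesgue_on {-\<tau> j..0}. R i j s \<theta> *v snd z j \<theta>)"
  using assms by (simp add: P_op_def case_prod_beta)

lemma snd_T_outside: "\<not> (i \<in> {1..K} \<and> s \<in> {-\<tau> i..0}) \<Longrightarrow> snd (T z) i s = 0"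
  by (auto simp: P_op_def case_prod_beta)

section \<open>Invariance of the two spaces and linearity\<close>

lemma T_Z_space:
  assumes z: "z \<in> Z_space K \<tau>"
  shows "T z \<in> Z_space K \<tau>"
proof -
  have "snd (T z) i \<in> L2 {-\<tau> i..0}" if i: "i \<in> {1..K}" for i
  proof (rule iffD1[OF L2_cong])
    \<comment> \<open>The kernel terms are even continuous in \<open>s\<close>;
      \<open>S i s *v snd z i s\<close> is the only summand that need not be.\<close>
    have R: "(\<lambda>s. LINT \<theta>|lebesgue_on {-\<tau> j..0}. R i j s \<theta> *v snd z j \<theta>) \<in> L2 {-\<tau> i..0}" if "j \<in> {1..K}" for j
    proof -
      have "continuous_on {-\<tau> i..0} (\<lambda>s. LINT \<theta>|lebesgue_on {-\<tau> j..0}. R i j s \<theta> *v snd z j \<theta>)"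
        by (rule continuous_on_matrix_integral_operator[OF compact_Icc compact_Icc R_cont[OF i that] Z_L2[OF z that]])
      then show ?thesis
        unfolding L2_vec_iff by (intro allI L2_continuous compact_Icc continuous_on_component)
    qed
    show "(\<lambda>s. \<tau> K *\<^sub>R (transpose (Q i s) *v fst z) + \<tau> K *\<^sub>R (S i s *v snd z i s) +
        (\<Sum>j=1..K. LINT \<theta>|lebesgue_on {-\<tau> j..0}. R i j s \<theta> *v snd z j \<theta>)) \<in> L2 {-\<tau> i..0}"
      by (intro L2_add L2_sum R L2_continuous_scaleR compact_Icc continuous_on_const L2_matrix_vector_mult
          Qt_cont S_cont i Z_L2[OF z] L2_const)
  qed (rule snd_T[OF i, symmetric])
  then show ?thesis by (simp add: Z_space_def case_prod_beta)
qed

lemma T_X_space: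
  assumes z: "z \<in> X_space K \<tau>"
  shows "T z \<in> X_space K \<tau>"
proof -
  have "snd (T z) i \<in> W2 {-\<tau> i..0}" if i: "i \<in> {1..K}" for i
  proof (rule iffD1[OF W2_cong])
    have lt: "- \<tau> j < 0" if "j \<in> {1..K}" for j using tau_pos[OF that] by simp
    show "(\<lambda>s. \<tau> K *\<^sub>R (transpose (Q i s) *v fst z) + \<tau> K *\<^sub>R (S i s *v snd z i s) +
        (\<Sum>j=1..K. LINT \<theta>|lebesgue_on {-\<tau> j..0}. R i j s \<theta> *v snd z j \<theta>)) \<in> W2 {-\<tau> i..0}"
      by (intro W2_add W2_sum compact_Icc W2_matrix_integral_operator lt i R_W2 X_W2(1)[OF z]
          W2_bounded_linear[OF compact_Icc _ bounded_linear_scaleR_right]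
          W2_bounded_linear[OF compact_Icc Q_W2 bounded_linear_transpose_mult]
          W2_matrix_vector_mult S_W2)
  qed (rule snd_T[OF i, symmetric])
  moreover have "snd (T z) i 0 = fst (T z)" if i: "i \<in> {1..K}" for i
  proof -
    \<comment> \<open>At \<open>s = 0\<close> the kernel \<open>R i j\<close> becomes
      \<open>Q j\<close> and matches the integrals of the first component. Since
      \<open>snd z i 0\<close> is \<open>fst z\<close>, the two remaining terms combine to
      \<open>P *v fst z\<close>, the same vector for every \<open>i\<close>.\<close>
    have "(\<Sum>j=1..K. LINT \<theta>|lebesgue_on {-\<tau> j..0}. R i j 0 \<theta> *v snd z j \<theta>) =
        (\<Sum>j=1..K. LINT \<theta>|lebesgue_on {-\<tau> j..0}. Q j \<theta> *v snd z j \<theta>)"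
      using Q_eq[OF i] by (intro sum.cong refl Bochner_Integration.integral_cong) auto
    moreover have "P *v fst z = \<tau> K *\<^sub>R (transpose (Q i 0) *v fst z) + \<tau> K *\<^sub>R (S i 0 *v snd z i 0)"
      unfolding P_eq[OF i] X_W2(2)[OF z i]
      by (simp only: matrix_vector_mult_add_rdistrib scaleR_matrix_vector_assoc)
    ultimately show ?thesis
      unfolding fst_T snd_T[OF i zero_mem[OF i]] by (simp only:)
  qed
  moreover have "T z \<in> Z_space K \<tau>"
    by (rule T_Z_space[OF X_subset_Z[OF z]])
  ultimately show ?thesis by (simp add: X_space_def case_prod_beta)
qed

text \<open>Splitting the integrals needs integrable integrands, which square integrability of both
  arguments provides. Off the relevant indices and intervals both sides are the default value 0, so
  the equation holds literally.\<close>

lemma T_add: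
  assumes z: "z \<in> Z_space K \<tau>" and w: "w \<in> Z_space K \<tau>"
  shows "T (Z_add z w) = Z_add (T z) (T w)"
proof -
  have int: "(LINT \<theta>|lebesgue_on {-\<tau> i..0}. A \<theta> *v (snd z i \<theta> + snd w i \<theta>)) =
      (LINT \<theta>|lebesgue_on {-\<tau> i..0}. A \<theta> *v snd z i \<theta>) + (LINT \<theta>|lebesgue_on {-\<tau> i..0}. A \<theta> *v snd w i \<theta>)"
    if "i \<in> {1..K}" "continuous_on {-\<tau> i..0} A" for i and A :: "real \<Rightarrow> real ^ 'n ^ 'n"
    unfolding matrix_vector_right_distrib
    by (intro Bochner_Integration.integral_add integrable_matrix_vector_mult compact_Icc that Z_L2 z w)
  have sum_int: "(\<Sum>i=1..K. LINT \<theta>|lebesgue_on {-\<tau> i..0}. A i \<theta> *v (snd z i \<theta> + snd w i \<theta>)) =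
      (\<Sum>i=1..K. LINT \<theta>|lebesgue_on {-\<tau> i..0}. A i \<theta> *v snd z i \<theta>) +
      (\<Sum>i=1..K. LINT \<theta>|lebesgue_on {-\<tau> i..0}. A i \<theta> *v snd w i \<theta>)"
    if "\<And>i. i \<in> {1..K} \<Longrightarrow> continuous_on {-\<tau> i..0} (A i)" for A :: "nat \<Rightarrow> real \<Rightarrow> real ^ 'n ^ 'n"
    unfolding sum.distrib[symmetric] by (intro sum.cong refl int that)
  have "fst (T (Z_add z w)) = fst (Z_add (T z) (T w))"
    unfolding fst_T Z_add_def fst_conv snd_conv
    by (subst sum_int[of Q]) (simp_all only: Q_cont matrix_vector_right_distrib ac_simps)
  moreover have "snd (T (Z_add z w)) i s = snd (Z_add (T z) (T w)) i s" for i s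
  proof (cases "i \<in> {1..K} \<and> s \<in> {-\<tau> i..0}")
    case True
    then have i: "i \<in> {1..K}" and s: "s \<in> {-\<tau> i..0}" by auto
    show ?thesis
      unfolding Z_add_def fst_conv snd_conv snd_T[OF i s]
      by (subst sum_int[of "\<lambda>j. R i j s"])
         (simp_all only: R_section_cont[OF i _ s] matrix_vector_right_distrib scaleR_add_right ac_simps)
  next
    case False
    show ?thesis by (simp only: snd_T_outside[OF False] Z_add_def snd_conv add_0)
  qed
  ultimately show ?thesis by (simp add: prod_eq_iff fun_eq_iff)
qed

lemma T_scale:
  assumes z: "z \<in> Z_space K \<tau>"
  shows "T (Z_scale c z) = Z_scale c (T z)"
proof -
  have "fst (T (Z_scale c z)) = fst (Z_scale c (T z))"
    by (simp add: fst_T Z_scale_def matrix_vector_mult_scaleR scaleR_add_right scaleR_sum_right)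
  moreover have "snd (T (Z_scale c z)) i s = snd (Z_scale c (T z)) i s" for i s
  proof (cases "i \<in> {1..K} \<and> s \<in> {-\<tau> i..0}")
    case True
    then have i: "i \<in> {1..K}" and s: "s \<in> {-\<tau> i..0}" by auto
    show ?thesis
      unfolding Z_scale_def fst_conv snd_conv snd_T[OF i s]
      by (simp add: matrix_vector_mult_scaleR scaleR_add_right scaleR_sum_right mult.commute)
  next
    case False
    show ?thesis by (simp only: snd_T_outside[OF False] Z_scale_def snd_conv scaleR_zero_right)
  qed
  ultimately show ?thesis by (simp add: prod_eq_iff fun_eq_iff)
qed

section \<open>Boundedness\<close>

lemma Z_inner_self: "Z_inner K \<tau> z z = \<tau> K * (norm (fst z))\<^sup>2 +
    (\<Sum>i=1..K. LINT s|lebesgue_on {-\<tau> i..0}. (norm (snd z i s))\<^sup>2)"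
  by (simp add: Z_inner_def power2_norm_eq_inner)

lemma Z_norm_square: "(Z_norm K \<tau> z)\<^sup>2 = Z_inner K \<tau> z z"
proof -
  have "0 \<le> Z_inner K \<tau> z z"
    unfolding Z_inner_self using tau_K_pos by (intro add_nonneg_nonneg sum_nonneg integral_nonneg_AE) auto
  then show ?thesis by (simp add: Z_norm_def)
qed

lemma Z_norm_nonneg: "0 \<le> Z_norm K \<tau> z"
  by (metis Z_norm_def Z_norm_square real_sqrt_ge_zero zero_le_power2)

text \<open>The squared norm is a sum of nonnegative terms and dominates each of them;
  \<open>sqrt (\<tau> K)\<close> undoes the weight of the first component.\<close>

lemma component_le_Z_norm:
  shows "norm (fst z) \<le> Z_norm K \<tau> z / sqrt (\<tau> K)"
    and "i \<in> {1..K} \<Longrightarrow> (LINT s|lebesgue_on {-\<tau> i..0}. (norm (snd z i s))\<^sup>2) \<le> (Z_norm K \<tau> z)\<^sup>2"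
proof -
  let ?n = "\<lambda>i. LINT s|lebesgue_on {-\<tau> i..0}. (norm (snd z i s))\<^sup>2"
  have n: "0 \<le> ?n i" for i by (intro integral_nonneg_AE) auto
  have "\<tau> K * (norm (fst z))\<^sup>2 \<le> (Z_norm K \<tau> z)\<^sup>2"
    unfolding Z_norm_square Z_inner_self using n by (simp add: sum_nonneg)
  then have "sqrt (\<tau> K) * norm (fst z) \<le> Z_norm K \<tau> z"
    using tau_K_pos by (intro power2_le_imp_le[OF _ Z_norm_nonneg]) (simp add: power_mult_distrib)
  then show "norm (fst z) \<le> Z_norm K \<tau> z / sqrt (\<tau> K)"
    using tau_K_pos by (simp add: field_simps)
  assume "i \<in> {1..K}"
  then have "?n i \<le> (\<Sum>i=1..K. ?n i)"
    using n by (intro member_le_sum) auto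
  then show "?n i \<le> (Z_norm K \<tau> z)\<^sup>2"
    unfolding Z_norm_square Z_inner_self using tau_K_pos by (simp add: add_increasing)
qed

lemma norm_integral_le_Z_norm:
  assumes z: "z \<in> Z_space K \<tau>" and i: "i \<in> {1..K}" and A: "continuous_on {-\<tau> i..0} A"
    and B: "0 \<le> B" "\<And>s v. s \<in> {-\<tau> i..0} \<Longrightarrow> norm (A s *v v) \<le> B * norm v"
  shows "norm (LINT \<theta>|lebesgue_on {-\<tau> i..0}. A \<theta> *v snd z i \<theta>) \<le> B * sqrt (\<tau> i) * Z_norm K \<tau> z"
proof -
  let ?n = "sqrt (LINT s|lebesgue_on {-\<tau> i..0}. (norm (snd z i s))\<^sup>2)"
  have "measure lebesgue {-\<tau> i..0} = \<tau> i"
    using tau_pos[OF i] by simp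
  with norm_integral_matrix_vector_mult_le[OF compact_Icc A Z_L2[OF z i] B]
  have "norm (LINT \<theta>|lebesgue_on {-\<tau> i..0}. A \<theta> *v snd z i \<theta>) \<le> B * (sqrt (\<tau> i) * ?n)"
    by (simp only:)
  also have "?n \<le> sqrt ((Z_norm K \<tau> z)\<^sup>2)"
    by (rule real_sqrt_le_mono[OF component_le_Z_norm(2)[OF i]])
  then have "B * (sqrt (\<tau> i) * ?n) \<le> B * (sqrt (\<tau> i) * Z_norm K \<tau> z)"
    using B(1) tau_pos[OF i] Z_norm_nonneg[of z] by (intro mult_left_mono) auto
  finally show ?thesis by (simp only: mult.assoc)
qed

lemma fst_T_bound: "\<exists>C\<ge>0. \<forall>z\<in>Z_space K \<tau>. norm (fst (T z)) \<le> C * Z_norm K \<tau> z"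
proof -
  have "\<forall>i\<in>{1..K}. \<exists>B\<ge>0. \<forall>s\<in>{-\<tau> i..0}. \<forall>v. norm (Q i s *v v) \<le> B * norm v"
    by (intro ballI matrix_bound_on_compact compact_Icc Q_cont)
  from bchoice[OF this] obtain B where B: "\<And>i. i \<in> {1..K} \<Longrightarrow> 0 \<le> B i"
    "\<And>i s v. i \<in> {1..K} \<Longrightarrow> s \<in> {-\<tau> i..0} \<Longrightarrow> norm (Q i s *v v) \<le> B i * norm v"
    by blast
  \<comment> \<open>A constant family over a one-point compact set turns the uniform bound into a
    bound for a single matrix.\<close>
  obtain p where p: "0 \<le> p" "\<And>v. norm (P *v v) \<le> p * norm v"
    using matrix_bound_on_compact[of "{0::real}" "\<lambda>_. P"] by (auto simp: continuous_on_const)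
  let ?C = "p / sqrt (\<tau> K) + (\<Sum>i=1..K. B i * sqrt (\<tau> i))"
  have "norm (fst (T z)) \<le> ?C * Z_norm K \<tau> z" if z: "z \<in> Z_space K \<tau>" for z
  proof -
    have "norm (fst (T z)) \<le> norm (P *v fst z) +
        (\<Sum>i=1..K. norm (LINT \<theta>|lebesgue_on {-\<tau> i..0}. Q i \<theta> *v snd z i \<theta>))"
      unfolding fst_T by (intro norm_triangle_le add_left_mono norm_sum)
    also have "\<dots> \<le> p * (Z_norm K \<tau> z / sqrt (\<tau> K)) + (\<Sum>i=1..K. B i * sqrt (\<tau> i) * Z_norm K \<tau> z)"
      by (intro add_mono sum_mono norm_integral_le_Z_norm z Q_cont B order_trans[OF p(2)]
          mult_left_mono component_le_Z_norm(1) p(1))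
    also have "\<dots> = ?C * Z_norm K \<tau> z"
      unfolding sum_distrib_right[symmetric] by (simp add: algebra_simps)
    finally show ?thesis .
  qed
  moreover have "0 \<le> ?C"
    using p(1) tau_K_pos B(1) tau_pos by (intro add_nonneg_nonneg divide_nonneg_nonneg sum_nonneg mult_nonneg_nonneg) (auto simp: less_imp_le)
  ultimately show ?thesis by blast
qed

text \<open>\<open>S i\<close> multiplies pointwise, and values of an \<open>L2\<close> function are
  not controlled by its norm. The estimate therefore keeps \<open>norm (snd z i s)\<close>, to be
  integrated later, with a constant uniform in \<open>s\<close>.\<close>

lemma snd_T_bound:
  assumes i: "i \<in> {1..K}"
  shows "\<exists>C\<ge>0. \<forall>z\<in>Z_space K \<tau>. \<forall>s\<in>{-\<tau> i..0}. norm (snd (T z) i s) \<le> C * (Z_norm K \<tau> z + norm (snd z i s))"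
proof -
  have "\<forall>j\<in>{1..K}. \<exists>B. 0 \<le> B \<and>
      (\<forall>s\<in>{-\<tau> i..0}. \<forall>\<theta>\<in>{-\<tau> j..0}. \<forall>v. norm (R i j s \<theta> *v v) \<le> B * norm v)"
  proof
    fix j assume j: "j \<in> {1..K}"
    obtain B where B: "0 \<le> B" "\<forall>z\<in>{-\<tau> i..0} \<times> {-\<tau> j..0}. \<forall>v.
        norm ((case z of (s, \<theta>) \<Rightarrow> R i j s \<theta>) *v v) \<le> B * norm v"
      using matrix_bound_on_compact[OF compact_Times[OF compact_Icc compact_Icc] R_cont[OF i j]] by (elim exE conjE)
    have "norm (R i j s \<theta> *v v) \<le> B * norm v" if "s \<in> {-\<tau> i..0}" "\<theta> \<in> {-\<tau> j..0}" for s \<theta> v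
      using B(2)[rule_format, of "(s, \<theta>)" v] that by simp
    with B(1) show "\<exists>B. 0 \<le> B \<and>
        (\<forall>s\<in>{-\<tau> i..0}. \<forall>\<theta>\<in>{-\<tau> j..0}. \<forall>v. norm (R i j s \<theta> *v v) \<le> B * norm v)" by blast
  qed
  from bchoice[OF this] obtain B where B: "\<And>j. j \<in> {1..K} \<Longrightarrow> 0 \<le> B j"
    "\<And>j s \<theta> v. j \<in> {1..K} \<Longrightarrow> s \<in> {-\<tau> i..0} \<Longrightarrow> \<theta> \<in> {-\<tau> j..0} \<Longrightarrow> norm (R i j s \<theta> *v v) \<le> B j * norm v"
    by blast
  obtain q where q: "0 \<le> q" "\<And>s v. s \<in> {-\<tau> i..0} \<Longrightarrow> norm (transpose (Q i s) *v v) \<le> q * norm v"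
    using matrix_bound_on_compact[OF compact_Icc Qt_cont[OF i]] by blast
  obtain r where r: "0 \<le> r" "\<And>s v. s \<in> {-\<tau> i..0} \<Longrightarrow> norm (S i s *v v) \<le> r * norm v"
    using matrix_bound_on_compact[OF compact_Icc S_cont[OF i]] by blast
  \<comment> \<open>The coefficient of \<open>Z_norm\<close>: the term with \<open>Q i\<close> pays
    \<open>1 / sqrt (\<tau> K)\<close> for the vector, and each kernel integral pays the root of its
    interval length.\<close>
  let ?D = "\<tau> K * q / sqrt (\<tau> K) + (\<Sum>j=1..K. B j * sqrt (\<tau> j))"
  have D: "0 \<le> ?D"
    using q(1) tau_K_pos B(1) tau_pos by (intro add_nonneg_nonneg divide_nonneg_nonneg sum_nonneg mult_nonneg_nonneg) (auto simp: less_imp_le)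
  have rK: "0 \<le> \<tau> K * r" using r tau_K_pos by simp
  have "norm (snd (T z) i s) \<le> (?D + \<tau> K * r) * (Z_norm K \<tau> z + norm (snd z i s))"
    if z: "z \<in> Z_space K \<tau>" and s: "s \<in> {-\<tau> i..0}" for z s
  proof -
    have "norm (snd (T z) i s) \<le> \<tau> K * norm (transpose (Q i s) *v fst z) + \<tau> K * norm (S i s *v snd z i s) +
        (\<Sum>j=1..K. norm (LINT \<theta>|lebesgue_on {-\<tau> j..0}. R i j s \<theta> *v snd z j \<theta>))"
      unfolding snd_T[OF i s] using tau_K_pos by (intro norm_triangle_le add_mono norm_sum) auto
    also have "\<dots> \<le> \<tau> K * (q * (Z_norm K \<tau> z / sqrt (\<tau> K))) + \<tau> K * (r * norm (snd z i s)) +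
        (\<Sum>j=1..K. B j * sqrt (\<tau> j) * Z_norm K \<tau> z)"
      using tau_K_pos s
      by (intro add_mono sum_mono norm_integral_le_Z_norm z R_section_cont i B mult_left_mono q(1) r(2)
          order_trans[OF q(2)] component_le_Z_norm(1)) auto
    also have "\<dots> = ?D * Z_norm K \<tau> z + \<tau> K * r * norm (snd z i s)"
      unfolding sum_distrib_right[symmetric] by (simp add: algebra_simps)
    also have "\<dots> \<le> ?D * (Z_norm K \<tau> z + norm (snd z i s)) + \<tau> K * r * (Z_norm K \<tau> z + norm (snd z i s))"
      using D rK Z_norm_nonneg[of z] by (intro add_mono mult_left_mono) auto
    finally show ?thesis by (simp only: distrib_right)
  qed
  moreover have "0 \<le> ?D + \<tau> K * r" using D rK by simp
  ultimately show ?thesis by blast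
qed

lemma T_bounded: "\<exists>C. \<forall>z\<in>Z_space K \<tau>. Z_norm K \<tau> (T z) \<le> C * Z_norm K \<tau> z"
proof -
  obtain C0 where C0: "0 \<le> C0" "\<And>z. z \<in> Z_space K \<tau> \<Longrightarrow> norm (fst (T z)) \<le> C0 * Z_norm K \<tau> z"
    using fst_T_bound by blast
  have "\<forall>i\<in>{1..K}. \<exists>C. 0 \<le> C \<and> (\<forall>z\<in>Z_space K \<tau>. \<forall>s\<in>{-\<tau> i..0}.
      norm (snd (T z) i s) \<le> C * (Z_norm K \<tau> z + norm (snd z i s)))"
    by (intro ballI snd_T_bound)
  from bchoice[OF this] obtain C where C: "\<And>i. i \<in> {1..K} \<Longrightarrow> 0 \<le> C i"
    "\<And>i z s. i \<in> {1..K} \<Longrightarrow> z \<in> Z_space K \<tau> \<Longrightarrow> s \<in> {-\<tau> i..0} \<Longrightarrow>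
      norm (snd (T z) i s) \<le> C i * (Z_norm K \<tau> z + norm (snd z i s))"
    by blast
  \<comment> \<open>Here 2 comes from
    \<open>(x + y)\<^sup>2 \<le> 2 * (x\<^sup>2 + y\<^sup>2)\<close>, the summand
    \<open>\<tau> i\<close> from integrating the constant squared norm over the interval, and the
    summand 1 from the i-th component of \<open>z\<close>.\<close>
  let ?M = "\<tau> K * C0\<^sup>2 + (\<Sum>i=1..K. 2 * (C i)\<^sup>2 * (\<tau> i + 1))"
  have M: "0 \<le> ?M"
    using tau_K_pos tau_pos by (intro add_nonneg_nonneg sum_nonneg mult_nonneg_nonneg) (auto simp: less_imp_le add_nonneg_nonneg)
  have "Z_norm K \<tau> (T z) \<le> sqrt ?M * Z_norm K \<tau> z" if z: "z \<in> Z_space K \<tau>" for z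
  proof (rule power2_le_imp_le)
    let ?e = "Z_norm K \<tau> z"
    have comp: "(LINT s|lebesgue_on {-\<tau> i..0}. (norm (snd (T z) i s))\<^sup>2) \<le> 2 * (C i)\<^sup>2 * (\<tau> i + 1) * ?e\<^sup>2"
      if i: "i \<in> {1..K}" for i
    proof -
      have pw: "(norm (snd (T z) i s))\<^sup>2 \<le> 2 * (C i)\<^sup>2 * (?e\<^sup>2 + (norm (snd z i s))\<^sup>2)" if "s \<in> {-\<tau> i..0}" for s
      proof -
        have "(norm (snd (T z) i s))\<^sup>2 \<le> (C i * (?e + norm (snd z i s)))\<^sup>2"
          by (rule power_mono[OF C(2)[OF i z that] norm_ge_zero])
        also have "\<dots> \<le> (C i)\<^sup>2 * (2 * (?e\<^sup>2 + (norm (snd z i s))\<^sup>2))"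
          unfolding power_mult_distrib
          using sum_squares_bound[of ?e "norm (snd z i s)"] by (intro mult_left_mono) (auto simp: power2_sum)
        finally show ?thesis by (simp add: algebra_simps)
      qed
      have iz: "integrable (lebesgue_on {-\<tau> i..0}) (\<lambda>s. (norm (snd z i s))\<^sup>2)"
        by (rule L2_D(2)[OF Z_L2[OF z i]])
      have "(LINT s|lebesgue_on {-\<tau> i..0}. (norm (snd (T z) i s))\<^sup>2) \<le>
          (LINT s|lebesgue_on {-\<tau> i..0}. 2 * (C i)\<^sup>2 * (?e\<^sup>2 + (norm (snd z i s))\<^sup>2))"
        using L2_D(2)[OF Z_L2[OF T_Z_space[OF z] i]] iz pw by (intro integral_mono) auto
      also have "\<dots> = 2 * (C i)\<^sup>2 * (?e\<^sup>2 * \<tau> i + (LINT s|lebesgue_on {-\<tau> i..0}. (norm (snd z i s))\<^sup>2))"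
        using iz tau_pos[OF i] by (simp add: measure_restrict_space)
      also have "\<dots> \<le> 2 * (C i)\<^sup>2 * (?e\<^sup>2 * \<tau> i + ?e\<^sup>2)"
        using component_le_Z_norm(2)[OF i, of z] by (intro mult_left_mono) auto
      finally show ?thesis by (simp add: algebra_simps)
    qed
    have "(Z_norm K \<tau> (T z))\<^sup>2 \<le> \<tau> K * (C0 * ?e)\<^sup>2 + (\<Sum>i=1..K. 2 * (C i)\<^sup>2 * (\<tau> i + 1) * ?e\<^sup>2)"
      unfolding Z_norm_square[of "T z"] Z_inner_self
      using tau_K_pos by (intro add_mono sum_mono comp mult_left_mono power_mono C0(2)[OF z]) auto
    also have "\<dots> = ?M * ?e\<^sup>2"
      unfolding sum_distrib_right[symmetric] by (simp add: power_mult_distrib algebra_simps)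
    also have "\<dots> = (sqrt ?M * ?e)\<^sup>2"
      using M by (simp add: power_mult_distrib)
    finally show "(Z_norm K \<tau> (T z))\<^sup>2 \<le> (sqrt ?M * ?e)\<^sup>2" .
    show "0 \<le> sqrt ?M * ?e"
      using M Z_norm_nonneg[of z] by simp
  qed
  then show ?thesis by blast
qed

section \<open>Self-adjointness\<close>

lemma P_sym: "transpose P = P"
proof -
  \<comment> \<open>\<open>Q K 0\<close> is the diagonal value \<open>R K K 0 0\<close>, which the
    symmetry of the kernels makes a symmetric matrix.\<close>
  have Q: "transpose (Q K 0) = Q K 0"
    unfolding Q_eq[OF K_mem K_mem zero_mem[OF K_mem]]
    by (rule R_sym[OF K_mem K_mem zero_mem[OF K_mem] zero_mem[OF K_mem], symmetric])
  have S: "transpose (S K 0) = S K 0"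
    by (rule S_sym[OF K_mem zero_mem[OF K_mem], symmetric])
  have P: "P = \<tau> K *\<^sub>R Q K 0 + \<tau> K *\<^sub>R S K 0"
    using P_eq[OF K_mem] unfolding Q .
  have "transpose P = \<tau> K *\<^sub>R transpose (Q K 0) + \<tau> K *\<^sub>R transpose (S K 0)"
    unfolding P by (simp add: vec_eq_iff transpose_def)
  then show ?thesis
    unfolding Q S P[symmetric] .
qed

text \<open>The contribution of one kernel to the inner product, named so that its symmetry becomes
  an exchange of both indices and arguments.\<close>

definition kernel_form where
  "kernel_form i j \<phi> \<psi> = (LINT s|lebesgue_on {-\<tau> i..0}. \<phi> s \<bullet> (LINT \<theta>|lebesgue_on {-\<tau> j..0}. R i j s \<theta> *v \<psi> \<theta>))"

text \<open>For continuous \<phi> and \<psi> the integrand is continuous on the rectangle, so the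
  integrals may be exchanged; \<open>R_sym\<close> then moves the matrix to the other
  factor.\<close>

lemma kernel_form_swap:
  assumes i: "i \<in> {1..K}" and j: "j \<in> {1..K}"
    and \<phi>: "\<phi> \<in> W2 {-\<tau> i..0}" and \<psi>: "\<psi> \<in> W2 {-\<tau> j..0}"
  shows "kernel_form i j \<phi> \<psi> = kernel_form j i \<psi> \<phi>"
proof -
  let ?I = "{-\<tau> i..0}" and ?J = "{-\<tau> j..0}"
  have cont: "continuous_on (?I \<times> ?J) (\<lambda>(s, \<theta>). \<phi> s \<bullet> (R i j s \<theta> *v \<psi> \<theta>))"
    unfolding case_prod_beta'
    by (intro continuous_on_inner continuous_on_matrix_vector_mult
        R_cont[OF i j, unfolded case_prod_beta'] continuous_on_compose2[OF W2_D(1)[OF \<phi>]]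
        continuous_on_compose2[OF W2_D(1)[OF \<psi>]] continuous_intros) auto
  have "kernel_form i j \<phi> \<psi> = (LINT s|lebesgue_on ?I. LINT \<theta>|lebesgue_on ?J. \<phi> s \<bullet> (R i j s \<theta> *v \<psi> \<theta>))"
    unfolding kernel_form_def
    by (intro Bochner_Integration.integral_cong refl integral_inner_right[symmetric]
        integrable_matrix_vector_mult compact_Icc R_section_cont i j W2_D(2)[OF \<psi>]) auto
  also have "\<dots> = (LINT \<theta>|lebesgue_on ?J. LINT s|lebesgue_on ?I. \<phi> s \<bullet> (R i j s \<theta> *v \<psi> \<theta>))"
    by (rule integral_lebesgue_on_swap_continuous[OF cont])
  also have "\<dots> = (LINT \<theta>|lebesgue_on ?J. LINT s|lebesgue_on ?I. \<psi> \<theta> \<bullet> (R j i \<theta> s *v \<phi> s))"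
  proof (intro Bochner_Integration.integral_cong refl)
    fix \<theta> s assume "\<theta> \<in> space (lebesgue_on ?J)" "s \<in> space (lebesgue_on ?I)"
    then have "R i j s \<theta> = transpose (R j i \<theta> s)"
      by (intro R_sym i j) auto
    then have "\<phi> s \<bullet> (R i j s \<theta> *v \<psi> \<theta>) = (R j i \<theta> s *v \<phi> s) \<bullet> \<psi> \<theta>"
      by (simp only: inner_transpose_matrix_vector)
    then show "\<phi> s \<bullet> (R i j s \<theta> *v \<psi> \<theta>) = \<psi> \<theta> \<bullet> (R j i \<theta> s *v \<phi> s)"
      by (simp only: inner_commute)
  qed
  also have "\<dots> = kernel_form j i \<psi> \<phi>"
    unfolding kernel_form_def
    by (intro Bochner_Integration.integral_cong refl integral_inner_right
        integrable_matrix_vector_mult compact_Icc R_section_cont i j W2_D(2)[OF \<phi>]) auto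
  finally show ?thesis .
qed

text \<open>A form in which the exchange of \<open>z\<close> and \<open>w\<close> can be read off:
  the two sums with \<open>Q\<close> trade places, and the terms with \<open>P\<close>,
  \<open>S\<close> and \<open>R\<close> are each symmetric by themselves.\<close>

lemma Z_inner_T:
  assumes z: "z \<in> X_space K \<tau>" and w: "w \<in> X_space K \<tau>"
  shows "Z_inner K \<tau> z (T w) = \<tau> K * (fst z \<bullet> (P *v fst w)) +
    \<tau> K * (\<Sum>i=1..K. fst z \<bullet> (LINT \<theta>|lebesgue_on {-\<tau> i..0}. Q i \<theta> *v snd w i \<theta>)) +
    \<tau> K * (\<Sum>i=1..K. fst w \<bullet> (LINT \<theta>|lebesgue_on {-\<tau> i..0}. Q i \<theta> *v snd z i \<theta>)) +
    \<tau> K * (\<Sum>i=1..K. LINT s|lebesgue_on {-\<tau> i..0}. snd z i s \<bullet> (S i s *v snd w i s)) +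
    (\<Sum>i=1..K. \<Sum>j=1..K. kernel_form i j (snd z i) (snd w j))"
proof -
  have "(LINT s|lebesgue_on {-\<tau> i..0}. snd z i s \<bullet> snd (T w) i s) =
      \<tau> K * (fst w \<bullet> (LINT \<theta>|lebesgue_on {-\<tau> i..0}. Q i \<theta> *v snd z i \<theta>)) +
      \<tau> K * (LINT s|lebesgue_on {-\<tau> i..0}. snd z i s \<bullet> (S i s *v snd w i s)) +
      (\<Sum>j=1..K. kernel_form i j (snd z i) (snd w j))" if i: "i \<in> {1..K}" for i
  proof -
    let ?I = "{-\<tau> i..0}"
    note zc = W2_D(1)[OF X_W2(1)[OF z i]] and zL = W2_D(2)[OF X_W2(1)[OF z i]]
    note wc = W2_D(1)[OF X_W2(1)[OF w i]]
    let ?a = "\<lambda>s. fst w \<bullet> (Q i s *v snd z i s)" and ?b = "\<lambda>s. snd z i s \<bullet> (S i s *v snd w i s)"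
      and ?c = "\<lambda>j s. snd z i s \<bullet> (LINT \<theta>|lebesgue_on {-\<tau> j..0}. R i j s \<theta> *v snd w j \<theta>)"
    have ia: "integrable (lebesgue_on ?I) ?a" and ib: "integrable (lebesgue_on ?I) ?b"
      by (intro continuous_imp_integrable_real continuous_on_inner continuous_on_matrix_vector_mult
          continuous_on_const Q_cont S_cont i zc wc)+
    have ic: "integrable (lebesgue_on ?I) (?c j)" if j: "j \<in> {1..K}" for j
      by (intro continuous_imp_integrable_real continuous_on_inner zc
          continuous_on_matrix_integral_operator compact_Icc R_cont i j W2_D(2)[OF X_W2(1)[OF w j]])
    have "(LINT s|lebesgue_on ?I. snd z i s \<bullet> snd (T w) i s) =
        (LINT s|lebesgue_on ?I. \<tau> K * ?a s + \<tau> K * ?b s + (\<Sum>j=1..K. ?c j s))"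
    proof (intro Bochner_Integration.integral_cong refl)
      fix s assume "s \<in> space (lebesgue_on ?I)"
      then have s: "s \<in> ?I" by simp
      show "snd z i s \<bullet> snd (T w) i s = \<tau> K * ?a s + \<tau> K * ?b s + (\<Sum>j=1..K. ?c j s)"
        by (simp only: snd_T[OF i s] inner_add_right inner_scaleR_right inner_sum_right inner_transpose_matrix_vector
            inner_commute[of "Q i s *v snd z i s"])
    qed
    also have "\<dots> = \<tau> K * integral\<^sup>L (lebesgue_on ?I) ?a + \<tau> K * integral\<^sup>L (lebesgue_on ?I) ?b +
        (\<Sum>j=1..K. integral\<^sup>L (lebesgue_on ?I) (?c j))"
    proof -
      have "(LINT s|lebesgue_on ?I. \<tau> K * ?a s + \<tau> K * ?b s + (\<Sum>j=1..K. ?c j s)) =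
          (LINT s|lebesgue_on ?I. \<tau> K * ?a s + \<tau> K * ?b s) + (LINT s|lebesgue_on ?I. (\<Sum>j=1..K. ?c j s))"
        using ia ib by (intro Bochner_Integration.integral_add Bochner_Integration.integrable_add
            integrable_mult_right Bochner_Integration.integrable_sum ic)
      also have "(LINT s|lebesgue_on ?I. (\<Sum>j=1..K. ?c j s)) = (\<Sum>j=1..K. integral\<^sup>L (lebesgue_on ?I) (?c j))"
        by (intro Bochner_Integration.integral_sum ic)
      finally show ?thesis using ia ib by simp
    qed
    also have "integral\<^sup>L (lebesgue_on ?I) ?a = fst w \<bullet> (LINT \<theta>|lebesgue_on ?I. Q i \<theta> *v snd z i \<theta>)"
      by (rule integral_inner_right) (intro integrable_matrix_vector_mult compact_Icc Q_cont i zL)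
    finally show ?thesis by (simp add: kernel_form_def)
  qed
  then show ?thesis
    by (simp add: Z_inner_def fst_T inner_add_right inner_sum_right sum.distrib sum_distrib_left distrib_left)
qed

lemma T_self_adjoint: "self_adjoint_on_X K \<tau> T"
  unfolding self_adjoint_on_X_def
proof (intro ballI)
  fix z w :: "'n zvec" assume z: "z \<in> X_space K \<tau>" and w: "w \<in> X_space K \<tau>"
  have "fst z \<bullet> (P *v fst w) = fst w \<bullet> (P *v fst z)"
    using inner_transpose_matrix_vector[of "fst z" P "fst w"] by (simp only: P_sym inner_commute)
  moreover have "(\<Sum>i=1..K. LINT s|lebesgue_on {-\<tau> i..0}. snd z i s \<bullet> (S i s *v snd w i s)) =
      (\<Sum>i=1..K. LINT s|lebesgue_on {-\<tau> i..0}. snd w i s \<bullet> (S i s *v snd z i s))"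
  proof (intro sum.cong refl Bochner_Integration.integral_cong)
    fix i s assume i: "i \<in> {1..K}" and "s \<in> space (lebesgue_on {-\<tau> i..0})"
    then have St: "transpose (S i s) = S i s" by (intro S_sym[symmetric]) auto
    then show "snd z i s \<bullet> (S i s *v snd w i s) = snd w i s \<bullet> (S i s *v snd z i s)"
      using inner_transpose_matrix_vector[of "snd z i s" "S i s" "snd w i s"]
      by (simp only: St inner_commute)
  qed
  moreover have "(\<Sum>i=1..K. \<Sum>j=1..K. kernel_form i j (snd z i) (snd w j)) =
      (\<Sum>i=1..K. \<Sum>j=1..K. kernel_form i j (snd w i) (snd z j))"
    \<comment> \<open>After the order of summation is exchanged, the block with indices
      \<open>i\<close>, \<open>j\<close> on one side meets the block \<open>j\<close>,
      \<open>i\<close> on the other.\<close>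
    by (subst sum.swap) (intro sum.cong refl kernel_form_swap X_W2(1)[OF z] X_W2(1)[OF w])
  ultimately have "Z_inner K \<tau> z (T w) = Z_inner K \<tau> w (T z)"
    unfolding Z_inner_T[OF z w] Z_inner_T[OF w z] by simp
  then show "Z_inner K \<tau> z (T w) = Z_inner K \<tau> (T z) w"
    by (simp add: Z_inner_commute)
qed

end

theorem lemma4:
  fixes K :: nat and \<tau> :: "nat \<Rightarrow> real"
    and P :: "real ^ 'n ^ 'n"
    and Q S :: "nat \<Rightarrow> real \<Rightarrow> real ^ 'n ^ 'n"
    and R :: "nat \<Rightarrow> nat \<Rightarrow> real \<Rightarrow> real \<Rightarrow> real ^ 'n ^ 'n"
  assumes "1 \<le> K" and "0 < \<tau> 1" and "strict_mono_on {1..K} \<tau>"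
    and "\<And>i. i \<in> {1..K} \<Longrightarrow> Q i \<in> W2 {-\<tau> i..0}"
    and "\<And>i. i \<in> {1..K} \<Longrightarrow> S i \<in> W2 {-\<tau> i..0}"
    and "\<And>i j. i \<in> {1..K} \<Longrightarrow> j \<in> {1..K} \<Longrightarrow>
           (\<lambda>(s, \<theta>). R i j s \<theta>) \<in> W2 ({-\<tau> i..0} \<times> {-\<tau> j..0})"
    and "\<And>i s. i \<in> {1..K} \<Longrightarrow> s \<in> {-\<tau> i..0} \<Longrightarrow> S i s = transpose (S i s)"
    and "\<And>i j s \<theta>. i \<in> {1..K} \<Longrightarrow> j \<in> {1..K} \<Longrightarrow> s \<in> {-\<tau> i..0} \<Longrightarrow> \<theta> \<in> {-\<tau> j..0} \<Longrightarrow>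
           R i j s \<theta> = transpose (R j i \<theta> s)"
    and "\<And>i. i \<in> {1..K} \<Longrightarrow> P = \<tau> K *\<^sub>R transpose (Q i 0) + \<tau> K *\<^sub>R S i 0"
    and "\<And>i j s. i \<in> {1..K} \<Longrightarrow> j \<in> {1..K} \<Longrightarrow> s \<in> {-\<tau> j..0} \<Longrightarrow> Q j s = R i j 0 s"
  shows "bounded_linear_operator_on K \<tau> (Z_space K \<tau>) (P_op K \<tau> P Q S R) \<and>
         bounded_linear_operator_on K \<tau> (X_space K \<tau>) (P_op K \<tau> P Q S R) \<and>
         P_op K \<tau> P Q S R ` X_space K \<tau> \<subseteq> X_space K \<tau> \<and>
         self_adjoint_on_X K \<tau> (P_op K \<tau> P Q S R)"
proof -
  have pos: "0 < \<tau> i" if "i \<in> {1..K}" for i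
  proof (cases "i = 1")
    case False
    then have "\<tau> 1 < \<tau> i"
      using that assms(1) by (intro strict_mono_onD[OF assms(3)]) auto
    then show ?thesis using assms(2) by simp
  qed (use assms(2) in simp)
  interpret delay_operator K \<tau> P Q S R
    by unfold_locales (fact assms(1) pos assms(4-10))+
  \<comment> \<open>One constant serves both spaces, since \<open>X_space\<close> is a subset of
    \<open>Z_space\<close> with the same norm.\<close>
  obtain C where C: "\<forall>z\<in>Z_space K \<tau>. Z_norm K \<tau> (T z) \<le> C * Z_norm K \<tau> z"
    using T_bounded by blast
  have "bounded_linear_operator_on K \<tau> (Z_space K \<tau>) T"
    unfolding bounded_linear_operator_on_def using C T_Z_space T_add T_scale by blast
  moreover have "bounded_linear_operator_on K \<tau> (X_space K \<tau>) T"
    unfolding bounded_linear_operator_on_def using C T_X_space T_add T_scale X_subset_Z by blast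
  ultimately show ?thesis
    using T_X_space T_self_adjoint by blast
qed

end
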